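(* Let $f:\mathbb{R}\to\mathbb{R}$ be the restriction to $\mathbb{R}$ of an entire function. Then the following are equivalent: (a) $\sum_{n=0}^{\infty}\mathcal{K}^{n}[f](0)^2<\infty$; (b) for all $t\in\mathbb{R}$ the sum $\sum_{n=0}^{\infty}\mathcal{K}^{n}[f](t)^2$ converges, and its value is independent of $t\in\mathbb{R}$; (c) $f\in\mathbf{BL}(\pi)$.
   Context: $\mathbf{BL}(\pi)$ is the space of continuous $L^2(\mathbb{R})$ functions whose Fourier transform $\widehat f(\omega)=\int_{-\infty}^{\infty} f(t)e^{-i\omega t}\,dt$ is supported within $[-\pi,\pi]$. Let $P^{L}_n(\omega)=\sqrt{2n+1}\,L_n(\omega/\pi)$, where $L_n$ is the Legendre polynomial of degree $n$; thus $\frac{1}{2\pi}\int_{-\pi}^{\pi}P^L_n(\omega)P^L_m(\omega)\,d\omega=\delta(m-n)$, where $\delta(0)=1$ and $\delta(j)=0$ for $j\ne 0$. The chromatic derivatives associated with the Legendre polynomials are the linear differential operators $\mathcal{K}^{n}=(-i)^nP^L_n\!\left(i\,\frac{d}{dt}\right)$, i.e. each $\omega^k$ in $P_n^L(\omega)$ is replaced by $i^k\frac{d^k}{dt^k}$ and the result is multiplied by $(-i)^n$. These operators have real coefficients. *)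

theory Defs
  imports "HOL-Analysis.Analysis" "HOL-Computational_Algebra.Polynomial"
begin

text \<open>Legendre polynomials, by Rodrigues' formula
  \<open>L\<^sub>n(x) = 1/(2\<^sup>n n!) (d/dx)\<^sup>n (x\<^sup>2 - 1)\<^sup>n\<close>.\<close>

definition Legendre_poly :: "nat \<Rightarrow> real poly" where
  "Legendre_poly n = smult (1 / (2 ^ n * fact n)) ((pderiv ^^ n) ([:-1, 0, 1:] ^ n))"

definition normalized_Legendre :: "nat \<Rightarrow> real poly" where
  "normalized_Legendre n = smult (sqrt (2 * real n + 1)) (pcompose (Legendre_poly n) [:0, 1 / pi:])"

definition chromatic_deriv_complex :: "nat \<Rightarrow> (real \<Rightarrow> real) \<Rightarrow> real \<Rightarrow> complex" where
  "chromatic_deriv_complex n f t =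
     (- \<i>) ^ n * (\<Sum>k\<le>degree (normalized_Legendre n).
        complex_of_real (coeff (normalized_Legendre n) k) * \<i> ^ k * complex_of_real ((deriv ^^ k) f t))"

text \<open>Taking the real part loses nothing: see \<open>of_real_chromatic_deriv\<close> below.\<close>

definition chromatic_deriv :: "nat \<Rightarrow> (real \<Rightarrow> real) \<Rightarrow> real \<Rightarrow> real" where
  "chromatic_deriv n f t = Re (chromatic_deriv_complex n f t)"

lemma coeff_square_minus_one_power_odd:
  assumes "odd k"
  shows "coeff ([:-1, 0, 1:] ^ n :: real poly) k = 0"
proof -
  have "pcompose ([:-1, 0, 1:] ^ n) [:0, -1:] = ([:-1, 0, 1:] ^ n :: real poly)"
    by (induction n) (simp_all only: power_0 power_Suc pcompose_mult pcompose_1, simp add: pcompose_pCons)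
  then have "coeff ([:-1, 0, 1:] ^ n :: real poly) k = (-1) ^ k * coeff ([:-1, 0, 1:] ^ n) k"
    by (metis coeff_pcompose_linear)
  with assms show ?thesis by simp
qed

lemma coeff_normalized_Legendre_odd:
  assumes "odd (n + k)"
  shows "coeff (normalized_Legendre n) k = 0"
  using assms
  by (simp add: normalized_Legendre_def Legendre_poly_def coeff_pcompose_linear
      coeff_higher_pderiv coeff_square_minus_one_power_odd add.commute)

lemma of_real_chromatic_deriv:
  "complex_of_real (chromatic_deriv n f t) = chromatic_deriv_complex n f t"
proof -
  have unit_real: "(- \<i>) ^ n * \<i> ^ k \<in> \<real>" if "even (n + k)" for k
  proof -
    have "(- \<i>) ^ n * \<i> ^ k = (-1) ^ n * \<i> ^ (n + k)"
      by (simp add: power_minus[of \<i>] power_add)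
    with that show ?thesis
      by (auto elim!: evenE simp: power_mult)
  qed
  have "(- \<i>) ^ n * (complex_of_real (coeff (normalized_Legendre n) k) * \<i> ^ k
          * complex_of_real ((deriv ^^ k) f t)) \<in> \<real>" for k
  proof (cases "even (n + k)")
    case True
    have "((- \<i>) ^ n * \<i> ^ k) * (complex_of_real (coeff (normalized_Legendre n) k)
          * complex_of_real ((deriv ^^ k) f t)) \<in> \<real>"
      by (intro Reals_mult unit_real True) auto
    then show ?thesis by (simp only: mult_ac)
  qed (simp add: coeff_normalized_Legendre_odd)
  then have "chromatic_deriv_complex n f t \<in> \<real>"
    unfolding chromatic_deriv_complex_def sum_distrib_left by (intro sum_in_Reals) auto
  then show ?thesis by (simp add: chromatic_deriv_def)
qed

definition square_integrable :: "(real \<Rightarrow> complex) \<Rightarrow> bool" where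
  "square_integrable f \<longleftrightarrow>
     f \<in> borel_measurable lborel \<and> integrable lborel (\<lambda>t. (norm (f t))\<^sup>2)"

definition truncated_fourier :: "real \<Rightarrow> (real \<Rightarrow> complex) \<Rightarrow> real \<Rightarrow> complex" where
  "truncated_fourier r f \<omega> =
     (LINT t:{-r..r}|lborel. f t * exp (- \<i> * complex_of_real \<omega> * complex_of_real t))"

text \<open>A square integrable \<open>f\<close> need not be integrable, so its Fourier transform is the Plancherel
  one: the limit in mean square of the transforms of the truncations of \<open>f\<close>. It is determined
  only up to a null set, hence is a relation here. The \<open>nn_integral\<close> takes the value
  \<open>\<infinity>\<close>, and not \<open>0\<close>, at a difference that is not square integrable.\<close>

definition has_L2_fourier :: "(real \<Rightarrow> complex) \<Rightarrow> (real \<Rightarrow> complex) \<Rightarrow> bool" where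
  "has_L2_fourier f g \<longleftrightarrow> square_integrable f \<and> square_integrable g \<and>
     ((\<lambda>r. \<integral>\<^sup>+ \<omega>. ennreal ((norm (g \<omega> - truncated_fourier r f \<omega>))\<^sup>2) \<partial>lborel) \<longlongrightarrow> 0) at_top"

definition BL :: "real \<Rightarrow> (real \<Rightarrow> complex) set" where
  "BL B = {f. continuous_on UNIV f \<and> square_integrable f \<and>
     (\<exists>g. has_L2_fourier f g \<and> (AE \<omega> in lborel. \<omega> \<notin> {-B..B} \<longrightarrow> g \<omega> = 0))}"

end

theory Submission
  imports Defs "HOL-Probability.Levy" "HOL-Complex_Analysis.Cauchy_Integral_Formula"
begin

text \<open>
  If \<open>f(t) = 1/(2\<pi>) \<integral> g(\<omega>) e\<^sup>i\<^sup>\<omega>\<^sup>t d\<omega>\<close> with \<open>g\<close> square integrable on \<open>[-\<pi>, \<pi>]\<close>, then \<open>K\<^sup>n[f](t)\<close> is, up to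
  the unimodular factor \<open>i\<^sup>n\<close>, the \<open>n\<close>-th Legendre coefficient of \<open>g(\<omega>) e\<^sup>i\<^sup>\<omega>\<^sup>t\<close>. Parseval's identity
  makes the sum of the squares equal to \<open>1/(2\<pi>) \<integral> |g|\<^sup>2\<close>, whatever \<open>t\<close> is. Conversely, if the
  squares at \<open>0\<close> are summable, Riesz--Fischer provides a \<open>g\<close> with these Legendre coefficients; its
  inverse transform has the same derivatives at \<open>0\<close> as \<open>f\<close>, hence equals the entire \<open>f\<close>.

  The only Plancherel statement needed is the bound \<open>\<parallel>ft h\<parallel>\<^sup>2 \<le> 2\<pi> \<parallel>h\<parallel>\<^sup>2\<close>, obtained by inserting a
  Gaussian weight. Every identification of two functions (completeness of the Legendre system,
  inversion in mean square) goes through the injectivity of the Fourier transform on integrable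
  functions, applied after multiplication by a Gaussian where integrability is missing;
  injectivity itself is Levy's uniqueness theorem for characteristic functions.
\<close>

section \<open>Square integrable functions\<close>

text \<open>The two sides of the transform are not alike. On the frequency side everything lives on
  [-\<pi>, \<pi>], so square integrable functions are integrable there, integrals converge
  absolutely, and the moments of g determine its inverse transform through an exponential series. On
  the time side f is in general not integrable; its transform exists only as a mean square limit of
  truncations, and this limit has to be matched with g. The test functions for that purpose are
  modulated Gaussians and translated Gaussians: the transform exchanges the two families, so
  inversion for them is an explicit computation. Hypothesis (a) speaks of one point only, yet it
  suffices: K^n has order n, so its values at 0 form a triangular system with nonzero diagonal for
  the derivatives of f at 0, and these determine an entire function. The factor i^n stems from the
  parity of the Legendre polynomials: i d/dt multiplies e^(i\<omega>t) by -\<omega>, and (-i)^n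
  P_n(-\<omega>) = i^n P_n(\<omega>).\<close>

text \<open>Values in \<open>ennreal\<close> free the estimates from integrability side conditions:
  a measurable function outside L2 gets \<infinity>, where the Bochner integral would give
  0.\<close>

definition sqnorm :: "(real \<Rightarrow> complex) \<Rightarrow> ennreal" where
  "sqnorm f = (\<integral>\<^sup>+x. ennreal ((norm (f x))\<^sup>2) \<partial>lborel)"

lemma square_integrable_measurable [measurable_dest]:
  "square_integrable f \<Longrightarrow> f \<in> borel_measurable borel"
  by (simp add: square_integrable_def)

lemma square_integrable_iff_sqnorm:
  "square_integrable f \<longleftrightarrow> f \<in> borel_measurable borel \<and> sqnorm f < \<infinity>"
  unfolding square_integrable_def sqnorm_def
  by (auto simp: integrable_iff_bounded)

lemma square_integrableD:
  assumes "square_integrable f"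
  shows "integrable lborel (\<lambda>t. (norm (f t))\<^sup>2)" "sqnorm f < \<infinity>"
    "sqnorm f = ennreal (\<integral>t. (norm (f t))\<^sup>2 \<partial>lborel)"
  using assms square_integrable_iff_sqnorm[of f] unfolding square_integrable_def sqnorm_def
  by (auto simp: nn_integral_eq_integral)

text \<open>The factor 2 replaces the triangle inequality for norms and avoids square roots. It is
  harmless, since only finiteness and convergence to 0 are derived from it.\<close>

lemma norm_add_square_le:
  fixes a b :: "'a::real_normed_vector"
  shows "(norm (a + b))\<^sup>2 \<le> 2 * (norm a)\<^sup>2 + 2 * (norm b)\<^sup>2"
proof -
  have "(norm (a + b))\<^sup>2 \<le> (norm a + norm b)\<^sup>2"
    by (intro power_mono norm_triangle_ineq) auto
  also have "\<dots> \<le> 2 * (norm a)\<^sup>2 + 2 * (norm b)\<^sup>2"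
    using sum_squares_bound[of "norm a" "norm b"] by (simp add: power2_sum)
  finally show ?thesis .
qed

lemma sqnorm_add_le:
  assumes [measurable]: "f \<in> borel_measurable borel" "g \<in> borel_measurable borel"
  shows "sqnorm (\<lambda>x. f x + g x) \<le> 2 * sqnorm f + 2 * sqnorm g"
proof -
  have "sqnorm (\<lambda>x. f x + g x)
      \<le> (\<integral>\<^sup>+x. 2 * ennreal ((norm (f x))\<^sup>2) + 2 * ennreal ((norm (g x))\<^sup>2) \<partial>lborel)"
    unfolding sqnorm_def
  proof (rule nn_integral_mono)
    fix x
    have "ennreal ((norm (f x + g x))\<^sup>2) \<le> ennreal (2 * (norm (f x))\<^sup>2 + 2 * (norm (g x))\<^sup>2)"
      by (intro ennreal_leI norm_add_square_le)
    then show "ennreal ((norm (f x + g x))\<^sup>2)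
        \<le> 2 * ennreal ((norm (f x))\<^sup>2) + 2 * ennreal ((norm (g x))\<^sup>2)"
      by (simp add: ennreal_plus ennreal_mult')
  qed
  also have "\<dots> = 2 * sqnorm f + 2 * sqnorm g"
    unfolding sqnorm_def by (subst nn_integral_add) (auto simp: nn_integral_cmult)
  finally show ?thesis .
qed

lemma sqnorm_minus_commute: "sqnorm (\<lambda>x. f x - g x) = sqnorm (\<lambda>x. g x - f x)"
  unfolding sqnorm_def by (simp add: norm_minus_commute)

lemma sqnorm_cmult:
  "sqnorm (\<lambda>x. c * f x) = ennreal ((norm c)\<^sup>2) * sqnorm f" if "f \<in> borel_measurable borel"
  using that unfolding sqnorm_def
  by (simp add: norm_mult power_mult_distrib ennreal_mult' nn_integral_cmult)

lemma sqnorm_mono: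
  assumes "AE x in lborel. norm (f x) \<le> norm (g x)"
  shows "sqnorm f \<le> sqnorm g"
  unfolding sqnorm_def using assms
  by (intro nn_integral_mono_AE) (auto intro!: ennreal_leI power_mono)

lemma sqnorm_cong_AE:
  assumes "AE x in lborel. f x = g x"
  shows "sqnorm f = sqnorm g"
  unfolding sqnorm_def using assms by (intro nn_integral_cong_AE) auto

lemma square_integrable_mono:
  assumes "square_integrable g" "f \<in> borel_measurable borel" "AE x in lborel. norm (f x) \<le> norm (g x)"
  shows "square_integrable f"
  using assms sqnorm_mono[OF assms(3)] by (auto simp: square_integrable_iff_sqnorm)

lemma square_integrable_add [intro]:
  assumes "square_integrable f" "square_integrable g"
  shows "square_integrable (\<lambda>x. f x + g x)"
proof -
  have [measurable]: "f \<in> borel_measurable borel" "g \<in> borel_measurable borel"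
    using assms by (auto intro: square_integrable_measurable)
  have "sqnorm (\<lambda>x. f x + g x) \<le> 2 * sqnorm f + 2 * sqnorm g"
    by (rule sqnorm_add_le) auto
  also have "\<dots> < \<infinity>"
    using assms by (auto simp: square_integrable_iff_sqnorm ennreal_mult_less_top)
  finally show ?thesis by (auto simp: square_integrable_iff_sqnorm)
qed

lemma square_integrable_cmult [intro]:
  assumes "square_integrable f" shows "square_integrable (\<lambda>x. c * f x)"
  using assms by (auto simp: square_integrable_iff_sqnorm sqnorm_cmult ennreal_mult_less_top)

lemma square_integrable_diff [intro]:
  assumes "square_integrable f" "square_integrable g"
  shows "square_integrable (\<lambda>x. f x - g x)"
  using square_integrable_add[OF assms(1) square_integrable_cmult[OF assms(2), of "-1"]] by simp

lemma square_integrable_sum [intro]: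
  assumes "\<And>i. i \<in> A \<Longrightarrow> square_integrable (f i)"
  shows "square_integrable (\<lambda>x. \<Sum>i\<in>A. f i x)"
  using assms
proof (induction A rule: infinite_finite_induct)
  case (insert i A)
  then have "square_integrable (\<lambda>x. f i x + (\<Sum>i\<in>A. f i x))"
    by (intro square_integrable_add) auto
  with insert show ?case by simp
qed (auto simp: square_integrable_def)

lemma square_integrable_cnj [intro]:
  assumes "square_integrable f" shows "square_integrable (\<lambda>x. cnj (f x))"
  using assms borel_measurable_continuous_on[of cnj f lborel]
  by (simp add: square_integrable_def continuous_on_cnj)

lemma square_integrable_imp_integrable_mult:
  assumes "square_integrable f" "square_integrable g"
  shows "integrable lborel (\<lambda>x. f x * g x)"
proof (rule Bochner_Integration.integrable_bound)
  show "integrable lborel (\<lambda>x. (norm (f x))\<^sup>2 + (norm (g x))\<^sup>2)"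
    using assms by (auto simp: square_integrable_def)
  show "AE x in lborel. norm (f x * g x) \<le> norm ((norm (f x))\<^sup>2 + (norm (g x))\<^sup>2)"
  proof (rule AE_I2)
    fix x
    have "2 * (norm (f x) * norm (g x)) \<le> (norm (f x))\<^sup>2 + (norm (g x))\<^sup>2"
      using sum_squares_bound[of "norm (f x)" "norm (g x)"] by simp
    moreover have "0 \<le> norm (f x) * norm (g x)" by simp
    ultimately have "norm (f x) * norm (g x) \<le> (norm (f x))\<^sup>2 + (norm (g x))\<^sup>2"
      by linarith
    then show "norm (f x * g x) \<le> norm ((norm (f x))\<^sup>2 + (norm (g x))\<^sup>2)"
      by (simp add: norm_mult)
  qed
qed (use assms in \<open>auto intro!: borel_measurable_times square_integrable_measurable\<close>)

lemma norm_integral_mult_square_le: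
  assumes "square_integrable f" "square_integrable g"
  shows "ennreal ((norm (\<integral>x. f x * g x \<partial>lborel))\<^sup>2) \<le> sqnorm f * sqnorm g"
proof -
  have [measurable]: "f \<in> borel_measurable borel" "g \<in> borel_measurable borel"
    using assms by (auto intro: square_integrable_measurable)
  have "ennreal (norm (\<integral>x. f x * g x \<partial>lborel)) \<le> (\<integral>\<^sup>+x. norm (f x * g x) \<partial>lborel)"
    by (intro integral_norm_bound_ennreal square_integrable_imp_integrable_mult assms)
  also have "\<dots> = (\<integral>\<^sup>+x. ennreal (norm (f x)) * ennreal (norm (g x)) \<partial>lborel)"
    by (simp add: norm_mult ennreal_mult')
  finally have "(ennreal (norm (\<integral>x. f x * g x \<partial>lborel)))\<^sup>2 \<le> \<dots>\<^sup>2"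
    by (intro power_mono) auto
  also have "\<dots> \<le> (\<integral>\<^sup>+x. (ennreal (norm (f x)))\<^sup>2 \<partial>lborel) * (\<integral>\<^sup>+x. (ennreal (norm (g x)))\<^sup>2 \<partial>lborel)"
    by (rule Cauchy_Schwarz_nn_integral) auto
  finally show ?thesis by (simp add: sqnorm_def ennreal_power)
qed

lemma tendsto_ennreal_0D:
  assumes "\<And>x. 0 \<le> a x" "((\<lambda>x. ennreal (a x)) \<longlongrightarrow> 0) F"
  shows "(a \<longlongrightarrow> 0) F"
  using assms tendsto_ennreal_iff[of a F 0] by (simp add: always_eventually)

lemma tendsto_ennreal_0_sandwich:
  fixes a b :: "'a \<Rightarrow> ennreal"
  assumes "(b \<longlongrightarrow> 0) F" "\<And>x. a x \<le> b x"
  shows "(a \<longlongrightarrow> 0) F"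
  by (rule tendsto_sandwich[OF _ _ tendsto_const assms(1)]) (simp_all add: always_eventually assms(2))

lemma tendsto_norm_square_0D:
  fixes a :: "'a \<Rightarrow> 'b::real_normed_vector"
  assumes "((\<lambda>r. ennreal ((norm (a r - b))\<^sup>2)) \<longlongrightarrow> 0) F"
  shows "(a \<longlongrightarrow> b) F"
proof -
  have "((\<lambda>r. (norm (a r - b))\<^sup>2) \<longlongrightarrow> 0) F"
    by (rule tendsto_ennreal_0D[OF _ assms]) simp
  then have "((\<lambda>r. sqrt ((norm (a r - b))\<^sup>2)) \<longlongrightarrow> sqrt 0) F"
    by (rule tendsto_real_sqrt)
  then show ?thesis
    by - (rule LIM_zero_cancel[OF tendsto_norm_zero_cancel], simp)
qed

text \<open>By Cauchy-Schwarz the difference of the integrals is controlled by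
  \<open>sqnorm (\<lambda>x. u r x - v x) * sqnorm \<phi>\<close>. This carries identities for
  truncations and partial sums over to their mean square limits. The pairing has no conjugate, so it
  matches the multiplication formula for \<open>ft\<close>.\<close>

lemma tendsto_integral_mult_L2:
  assumes u: "\<And>r. square_integrable (u r)" and v: "square_integrable v" and \<phi>: "square_integrable \<phi>"
    and lim: "((\<lambda>r. sqnorm (\<lambda>x. u r x - v x)) \<longlongrightarrow> 0) F"
  shows "((\<lambda>r. \<integral>x. u r x * \<phi> x \<partial>lborel) \<longlongrightarrow> (\<integral>x. v x * \<phi> x \<partial>lborel)) F"
proof -
  have "((\<lambda>r. sqnorm \<phi> * sqnorm (\<lambda>x. u r x - v x)) \<longlongrightarrow> sqnorm \<phi> * 0) F"
    using square_integrableD(2)[OF \<phi>] by (intro ennreal_tendsto_cmult lim) simp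
  then have "((\<lambda>r. sqnorm (\<lambda>x. u r x - v x) * sqnorm \<phi>) \<longlongrightarrow> 0) F"
    by (simp add: mult.commute)
  moreover have "ennreal ((norm ((\<integral>x. u r x * \<phi> x \<partial>lborel) - (\<integral>x. v x * \<phi> x \<partial>lborel)))\<^sup>2)
      \<le> sqnorm (\<lambda>x. u r x - v x) * sqnorm \<phi>" for r
  proof -
    have "(\<integral>x. u r x * \<phi> x \<partial>lborel) - (\<integral>x. v x * \<phi> x \<partial>lborel) = (\<integral>x. (u r x - v x) * \<phi> x \<partial>lborel)"
      by (simp add: left_diff_distrib square_integrable_imp_integrable_mult u v \<phi>)
    then show ?thesis
      using norm_integral_mult_square_le[OF square_integrable_diff[OF u v] \<phi>] by simp
  qed
  ultimately have "((\<lambda>r. ennreal ((norm ((\<integral>x. u r x * \<phi> x \<partial>lborel) - (\<integral>x. v x * \<phi> x \<partial>lborel)))\<^sup>2)) \<longlongrightarrow> 0) F"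
    by (rule tendsto_ennreal_0_sandwich)
  then show ?thesis by (rule tendsto_norm_square_0D)
qed

text \<open>A subsequence with geometrically small increments converges almost everywhere, and
  Fatou's lemma shows that its pointwise limit is the mean square limit of the whole
  sequence.\<close>

lemma L2_complete:
  assumes u: "\<And>n. square_integrable (u n)"
    and Cauchy: "\<And>e. 0 < e \<Longrightarrow> \<exists>N. \<forall>m\<ge>N. \<forall>n\<ge>N. sqnorm (\<lambda>x. u m x - u n x) \<le> ennreal e"
  obtains v where "square_integrable v" "(\<lambda>n. sqnorm (\<lambda>x. u n x - v x)) \<longlonglongrightarrow> 0"
proof -
  have [measurable]: "u n \<in> borel_measurable borel" for n
    using u by (auto intro: square_integrable_measurable)
  have "\<forall>k. \<exists>N. \<forall>m\<ge>N. \<forall>n\<ge>N. sqnorm (\<lambda>x. u m x - u n x) \<le> ennreal ((1/4)^k)"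
    using Cauchy by simp
  then obtain M where M: "\<And>k m n. M k \<le> m \<Longrightarrow> M k \<le> n \<Longrightarrow>
      sqnorm (\<lambda>x. u m x - u n x) \<le> ennreal ((1/4)^k)"
    by metis
  \<comment> \<open>Summing the thresholds yields indices that are monotone in k and still at least
    \<open>M k\<close>.\<close>
  define s where "s k = (\<Sum>j\<le>k. M j)" for k
  have s_mono: "s j \<le> s k" if "j \<le> k" for j k
    unfolding s_def using that by (intro sum_mono2) auto
  have M_le_s: "M k \<le> s k" for k
    unfolding s_def by (intro member_le_sum) auto
  define w where "w k = u (s k)" for k
  define d where "d k x = w (Suc k) x - w k x" for k x
  have [measurable]: "w k \<in> borel_measurable borel" for k
    unfolding w_def by simp
  have [measurable]: "d k \<in> borel_measurable borel" for k
    unfolding d_def by measurable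
  have sq_d: "sqnorm (d k) \<le> ennreal ((1/4)^k)" for k
    unfolding d_def w_def
    using M[of k "s (Suc k)" "s k"] M_le_s[of k] s_mono[of k "Suc k"] by simp
  \<comment> \<open>The weights \<open>2\<^sup>k\<close> make the increments decay geometrically almost everywhere.\<close>
  have "(\<integral>\<^sup>+x. (\<Sum>k. ennreal (2^k * (norm (d k x))\<^sup>2)) \<partial>lborel)
      = (\<Sum>k. \<integral>\<^sup>+x. ennreal (2^k * (norm (d k x))\<^sup>2) \<partial>lborel)"
    by (rule nn_integral_suminf) simp
  also have "\<dots> \<le> (\<Sum>k. ennreal ((1/2)^k))"
  proof (intro suminf_le)
    fix k :: nat
    have "(\<integral>\<^sup>+x. ennreal (2^k * (norm (d k x))\<^sup>2) \<partial>lborel) = ennreal (2^k) * sqnorm (d k)"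
      unfolding sqnorm_def by (subst nn_integral_cmult[symmetric]) (auto simp: ennreal_mult')
    also have "\<dots> \<le> ennreal (2^k) * ennreal ((1/4)^k)"
      by (intro mult_left_mono sq_d) simp
    also have "\<dots> = ennreal ((1/2)^k)"
      by (simp add: ennreal_mult'[symmetric] power_mult_distrib[symmetric])
    finally show "(\<integral>\<^sup>+x. ennreal (2^k * (norm (d k x))\<^sup>2) \<partial>lborel) \<le> ennreal ((1/2)^k)" .
  qed auto
  also have "\<dots> = ennreal (\<Sum>k. (1/2)^k)"
    by (rule suminf_ennreal2) (auto simp: summable_geometric)
  finally have "(\<integral>\<^sup>+x. (\<Sum>k. ennreal (2^k * (norm (d k x))\<^sup>2)) \<partial>lborel) \<noteq> \<infinity>"
    by (metis ennreal_neq_top infinity_ennreal_def top.extremum_uniqueI)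
  then have "AE x in lborel. (\<Sum>k. ennreal (2^k * (norm (d k x))\<^sup>2)) \<noteq> \<infinity>"
    by (intro nn_integral_PInf_AE) auto
  then have conv: "AE x in lborel. convergent (\<lambda>k. w k x)"
  proof eventually_elim
    fix x
    assume "(\<Sum>k. ennreal (2^k * (norm (d k x))\<^sup>2)) \<noteq> \<infinity>"
    then have "summable (\<lambda>k. 2^k * (norm (d k x))\<^sup>2)"
      by (intro summable_suminf_not_top) auto
    then have "(\<lambda>k. 2^k * (norm (d k x))\<^sup>2) \<longlonglongrightarrow> 0"
      by (rule summable_LIMSEQ_zero)
    \<comment> \<open>Terms of a convergent series are eventually below 1, which already gives
      geometric decay of \<open>d k x\<close>.\<close>
    then have "eventually (\<lambda>k. 2^k * (norm (d k x))\<^sup>2 < 1) sequentially"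
      by (rule order_tendstoD) simp
    then have "eventually (\<lambda>k. norm (d k x) \<le> (sqrt (1/2))^k) sequentially"
    proof eventually_elim
      case (elim k)
      then have "(norm (d k x))\<^sup>2 \<le> (1/2)^k"
        by (simp add: field_simps power_one_over)
      then have "sqrt ((norm (d k x))\<^sup>2) \<le> sqrt ((1/2)^k)"
        by (rule real_sqrt_le_mono)
      then show ?case
        by (simp only: real_sqrt_abs abs_norm_cancel real_sqrt_power[of "1/2"])
    qed
    moreover have "summable (\<lambda>k. (sqrt (1/2))^k)"
      by (rule summable_geometric) (simp add: real_sqrt_lt_1_iff)
    ultimately have "summable (\<lambda>k. d k x)"
      by (rule summable_comparison_test_ev)
    then have "(\<lambda>n. (\<Sum>k<n. d k x)) \<longlonglongrightarrow> (\<Sum>k. d k x)"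
      by (rule summable_LIMSEQ)
    then have "(\<lambda>n. w 0 x + (\<Sum>k<n. d k x)) \<longlonglongrightarrow> w 0 x + (\<Sum>k. d k x)"
      by (intro tendsto_intros)
    moreover have "w 0 x + (\<Sum>k<n. d k x) = w n x" for n
      unfolding d_def using sum_lessThan_telescope[of "\<lambda>k. w k x" n] by simp
    ultimately show "convergent (\<lambda>k. w k x)"
      by (auto simp: convergent_def)
  qed
  \<comment> \<open>Where the subsequence diverges, \<open>lim\<close> is an unspecified value; this
    concerns a null set only.\<close>
  define v where "v x = lim (\<lambda>k. w k x)" for x
  have [measurable]: "v \<in> borel_measurable borel"
    unfolding v_def by (rule borel_measurable_lim_metric) simp
  have bound: "sqnorm (\<lambda>x. u n x - v x) \<le> ennreal ((1/4)^k)" if "s k \<le> n" for n k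
  proof -
    \<comment> \<open>Fatou's lemma in j, with n fixed: for j \<ge> k both \<open>u n\<close> and
      \<open>w j\<close> lie beyond the threshold \<open>M k\<close>.\<close>
    have "sqnorm (\<lambda>x. u n x - v x)
        = (\<integral>\<^sup>+x. liminf (\<lambda>j. ennreal ((norm (u n x - w j x))\<^sup>2)) \<partial>lborel)"
      unfolding sqnorm_def
    proof (rule nn_integral_cong_AE)
      show "AE x in lborel. ennreal ((norm (u n x - v x))\<^sup>2)
          = liminf (\<lambda>j. ennreal ((norm (u n x - w j x))\<^sup>2))"
        using conv
      proof eventually_elim
        fix x assume "convergent (\<lambda>k. w k x)"
        then have "(\<lambda>k. w k x) \<longlonglongrightarrow> v x"
          unfolding v_def by (simp add: convergent_LIMSEQ_iff)
        then have "(\<lambda>j. ennreal ((norm (u n x - w j x))\<^sup>2)) \<longlonglongrightarrow> ennreal ((norm (u n x - v x))\<^sup>2)"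
          by (intro tendsto_ennrealI tendsto_intros)
        then show "ennreal ((norm (u n x - v x))\<^sup>2)
            = liminf (\<lambda>j. ennreal ((norm (u n x - w j x))\<^sup>2))"
          using lim_imp_Liminf[of sequentially] by fastforce
      qed
    qed
    also have "\<dots> \<le> liminf (\<lambda>j. sqnorm (\<lambda>x. u n x - w j x))"
      unfolding sqnorm_def by (rule nn_integral_liminf) simp
    also have "\<dots> \<le> ennreal ((1/4)^k)"
    proof (rule Liminf_le)
      show "\<forall>\<^sub>F j in sequentially. sqnorm (\<lambda>x. u n x - w j x) \<le> ennreal ((1/4)^k)"
        using eventually_ge_at_top[of k]
      proof eventually_elim
        fix j assume "k \<le> j"
        then show "sqnorm (\<lambda>x. u n x - w j x) \<le> ennreal ((1/4)^k)"
          unfolding w_def using M_le_s[of k] s_mono[of k j] that by (intro M) auto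
      qed
    qed simp
    finally show ?thesis .
  qed
  have "sqnorm (\<lambda>x. u (s 0) x - v x) < \<infinity>"
    using bound[of 0 "s 0"] by (simp add: order.strict_trans1)
  then have "square_integrable (\<lambda>x. u (s 0) x - v x)"
    by (simp add: square_integrable_iff_sqnorm)
  from square_integrable_diff[OF u[of "s 0"] this] have v: "square_integrable v" by simp
  have "(\<lambda>n. sqnorm (\<lambda>x. u n x - v x)) \<longlonglongrightarrow> 0"
  proof (rule order_tendstoI)
    fix e :: ennreal assume "0 < e"
    have "(\<lambda>k. (1/4::real)^k) \<longlonglongrightarrow> 0"
      by (rule LIMSEQ_power_zero) simp
    then have "(\<lambda>k. ennreal ((1/4)^k)) \<longlonglongrightarrow> 0"
      using tendsto_ennrealI by fastforce
    from order_tendstoD(2)[OF this \<open>0 < e\<close>] obtain k where k: "ennreal ((1/4)^k) < e"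
      by (auto simp: eventually_sequentially)
    show "\<forall>\<^sub>F n in sequentially. sqnorm (\<lambda>x. u n x - v x) < e"
      using eventually_ge_at_top[of "s k"] by eventually_elim (use bound k le_less_trans in blast)
  qed simp
  with v show ?thesis by (rule that)
qed

section \<open>Fourier transform of integrable functions\<close>

text \<open>The positive and negative parts of h have the same transform. At frequency 0 this says
  that they have the same mass m. If m is 0, both vanish; otherwise division by m turns them into
  probability densities with equal characteristic functions, and Levy's theorem makes them
  agree.\<close>

lemma integral_iexp_eq_0_imp_AE_0_real:
  fixes h :: "real \<Rightarrow> real"
  assumes h: "integrable lborel h"
    and zero: "\<And>t. (\<integral>x. h x *\<^sub>R iexp (t * x) \<partial>lborel) = 0"
  shows "AE x in lborel. h x = 0"
proof -
  have [measurable]: "h \<in> borel_measurable borel" using h by auto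
  define p where "p x = max (h x) 0" for x
  define q where "q x = max (- h x) 0" for x
  have [measurable]: "p \<in> borel_measurable borel" "q \<in> borel_measurable borel"
    unfolding p_def q_def by measurable
  have pq: "h x = p x - q x" "0 \<le> p x" "0 \<le> q x" for x
    by (auto simp: p_def q_def)
  have int: "integrable lborel p" "integrable lborel q"
    unfolding p_def q_def using h by (auto intro!: integrable_max)
  have intc: "integrable lborel (\<lambda>x. p x *\<^sub>R iexp (t * x))" "integrable lborel (\<lambda>x. q x *\<^sub>R iexp (t * x))" for t
    by (rule Bochner_Integration.integrable_bound[OF int(1)], simp, simp,
        rule Bochner_Integration.integrable_bound[OF int(2)], simp, simp)
  have pqc: "(\<integral>x. p x *\<^sub>R iexp (t * x) \<partial>lborel) = (\<integral>x. q x *\<^sub>R iexp (t * x) \<partial>lborel)" for t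
    using zero[of t] Bochner_Integration.integral_diff[OF intc[of t]]
    by (simp add: pq(1) scaleR_left_diff_distrib)
  define m where "m = (\<integral>x. p x \<partial>lborel)"
  have mq: "m = (\<integral>x. q x \<partial>lborel)"
  proof -
    have "complex_of_real m = complex_of_real (\<integral>x. q x \<partial>lborel)"
      using pqc[of 0] by (simp add: m_def scaleR_conv_of_real)
    then show ?thesis by (simp only: of_real_eq_iff)
  qed
  have "0 \<le> m" unfolding m_def by (simp add: pq)
  show ?thesis
  proof (cases "m = 0")
    case True
    have "AE x in lborel. p x = 0" "AE x in lborel. q x = 0"
      using integral_nonneg_eq_0_iff_AE[OF int(1)] integral_nonneg_eq_0_iff_AE[OF int(2)] True mq
      by (auto simp: pq m_def)
    then show ?thesis by eventually_elim (simp add: pq)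
  next
    case False
    with \<open>0 \<le> m\<close> have "0 < m" by simp
    have dist: "real_distribution (density lborel (\<lambda>x. ennreal (r x / m)))"
      if [measurable]: "r \<in> borel_measurable borel" and r: "integrable lborel r" "\<And>x. 0 \<le> r x"
        "(\<integral>x. r x \<partial>lborel) = m" for r
    proof -
      have "(\<integral>\<^sup>+x. ennreal (r x / m) \<partial>lborel) = ennreal (\<integral>x. r x / m \<partial>lborel)"
        using r \<open>0 < m\<close> by (intro nn_integral_eq_integral) auto
      also have "\<dots> = 1" using r \<open>0 < m\<close> by simp
      finally have "prob_space (density lborel (\<lambda>x. ennreal (r x / m)))"
        by (intro prob_spaceI) (simp add: emeasure_density)
      then show ?thesis
        by (auto simp: real_distribution_def real_distribution_axioms_def)
    qed
    have ch: "char (density lborel (\<lambda>x. ennreal (r x / m))) t = (\<integral>x. r x *\<^sub>R iexp (t * x) \<partial>lborel) / m"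
      if [measurable]: "r \<in> borel_measurable borel" and "\<And>x. 0 \<le> r x" for r t
    proof -
      have "char (density lborel (\<lambda>x. ennreal (r x / m))) t = (\<integral>x. (r x / m) *\<^sub>R iexp (t * x) \<partial>lborel)"
        unfolding char_def using that \<open>0 < m\<close> by (intro integral_density) auto
      also have "\<dots> = (\<integral>x. r x *\<^sub>R iexp (t * x) / m \<partial>lborel)"
        by (simp add: scaleR_conv_of_real)
      finally show ?thesis by simp
    qed
    have "char (density lborel (\<lambda>x. ennreal (p x / m))) = char (density lborel (\<lambda>x. ennreal (q x / m)))"
      by (rule ext) (simp only: ch[of p, OF _ pq(2)] ch[of q, OF _ pq(3)] pqc
          \<open>p \<in> borel_measurable borel\<close> \<open>q \<in> borel_measurable borel\<close>)
    then have "density lborel (\<lambda>x. ennreal (p x / m)) = density lborel (\<lambda>x. ennreal (q x / m))"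
      by (intro Levy_uniqueness dist int pq) (simp_all add: mq[symmetric] m_def[symmetric])
    then have "AE x in lborel. ennreal (p x / m) = ennreal (q x / m)"
      by (intro sigma_finite_measure.density_unique[OF lborel.sigma_finite_measure_axioms]) auto
    then show ?thesis
      by eventually_elim (use \<open>0 < m\<close> in \<open>simp add: pq\<close>)
  qed
qed

text \<open>Unnormalised, so that \<open>ft g (- t) / (2 * pi)\<close> is the inverse transform of
  g. A nonintegrable h yields the default value 0; hence integrability is assumed wherever
  \<open>ft\<close> is to be additive.\<close>

definition ft :: "(real \<Rightarrow> complex) \<Rightarrow> real \<Rightarrow> complex" where
  "ft h \<omega> = (\<integral>t. h t * exp (- \<i> * complex_of_real \<omega> * complex_of_real t) \<partial>lborel)"

lemma norm_exp_minus_i_times [simp]: "norm (exp (- \<i> * complex_of_real \<omega> * complex_of_real t)) = 1"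
  by (simp add: norm_exp_eq_Re)

lemma norm_exp_i_times [simp]: "norm (exp (\<i> * complex_of_real \<omega> * complex_of_real t)) = 1"
  by (simp add: norm_exp_eq_Re)

lemma integrable_ft:
  assumes "integrable lborel h"
  shows "integrable lborel (\<lambda>t. h t * exp (- \<i> * complex_of_real \<omega> * complex_of_real t))"
  by (rule Bochner_Integration.integrable_bound[OF assms]) (use assms in \<open>auto simp: norm_mult\<close>)

text \<open>Passing to \<open>cnj h\<close> conjugates the transform and reflects the frequency, so
  its transform vanishes as well. Hence so do those of the real and imaginary parts, which are
  combinations of h and \<open>cnj h\<close>.\<close>

lemma ft_eq_0_imp_AE_0:
  assumes h: "integrable lborel h" and zero: "\<And>\<omega>. ft h \<omega> = 0"
  shows "AE x in lborel. h x = 0"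
proof -
  have [measurable]: "h \<in> borel_measurable borel" using h by auto
  have z: "(\<integral>x. h x * iexp (t * x) \<partial>lborel) = 0" for t
    using zero[of "-t"] by (simp add: ft_def mult_ac)
  have ic: "integrable lborel (\<lambda>x. h x * iexp (t * x))" for t
    using integrable_ft[OF h, of "-t"] by (simp add: mult_ac)
  have z': "(\<integral>x. cnj (h x) * iexp (t * x) \<partial>lborel) = 0" for t
  proof -
    have "(\<integral>x. cnj (h x) * iexp (t * x) \<partial>lborel) = (\<integral>x. cnj (h x * iexp ((-t) * x)) \<partial>lborel)"
      by (simp add: exp_cnj)
    also have "\<dots> = cnj (\<integral>x. h x * iexp ((-t) * x) \<partial>lborel)"
      by (rule Bochner_Integration.integral_cnj)
    finally show ?thesis by (simp only: z complex_cnj_zero)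
  qed
  have ic': "integrable lborel (\<lambda>x. cnj (h x) * iexp (t * x))" for t
    using integrable_cnj[OF ic[of "-t"]] by (simp add: exp_cnj)
  have "AE x in lborel. Re (h x) = 0"
  proof (rule integral_iexp_eq_0_imp_AE_0_real)
    fix t
    have "(\<integral>x. Re (h x) *\<^sub>R iexp (t * x) \<partial>lborel)
        = (\<integral>x. (h x * iexp (t * x) + cnj (h x) * iexp (t * x)) / 2 \<partial>lborel)"
      by (intro Bochner_Integration.integral_cong refl)
         (simp add: scaleR_conv_of_real complex_add_cnj flip: distrib_right)
    also have "\<dots> = 0" by (simp only: integral_divide_zero Bochner_Integration.integral_add[OF ic ic'] z z')
         simp
    finally show "(\<integral>x. Re (h x) *\<^sub>R iexp (t * x) \<partial>lborel) = 0" .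
  qed (use h in simp)
  moreover have "AE x in lborel. Im (h x) = 0"
  proof (rule integral_iexp_eq_0_imp_AE_0_real)
    fix t
    have "(\<integral>x. Im (h x) *\<^sub>R iexp (t * x) \<partial>lborel)
        = (\<integral>x. (h x * iexp (t * x) - cnj (h x) * iexp (t * x)) / (2 * \<i>) \<partial>lborel)"
    proof (intro Bochner_Integration.integral_cong refl)
      fix x
      have "h x * iexp (t * x) - cnj (h x) * iexp (t * x) = 2 * \<i> * (complex_of_real (Im (h x)) * iexp (t * x))"
        by (simp add: complex_diff_cnj mult_ac flip: left_diff_distrib)
      then show "Im (h x) *\<^sub>R iexp (t * x) = (h x * iexp (t * x) - cnj (h x) * iexp (t * x)) / (2 * \<i>)"
        by (simp only: scaleR_conv_of_real) simp
    qed
    also have "\<dots> = 0" by (simp only: integral_divide_zero Bochner_Integration.integral_diff[OF ic ic'] z z')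
         simp
    finally show "(\<integral>x. Im (h x) *\<^sub>R iexp (t * x) \<partial>lborel) = 0" .
  qed (use h in simp)
  ultimately show ?thesis by eventually_elim (simp add: complex_eq_iff)
qed

section \<open>Gaussians and their transforms\<close>

text \<open>Scaled so that \<open>gauss 1\<close> is an eigenfunction of \<open>ft\<close>, with
  eigenvalue sqrt(2\<pi>). As a tends to 0 the weight tends to 1 pointwise.\<close>

definition gauss :: "real \<Rightarrow> real \<Rightarrow> complex" where
  "gauss a \<omega> = complex_of_real (exp (- (a * \<omega>\<^sup>2) / 2))"

lemma gauss_measurable [measurable]: "gauss a \<in> borel_measurable borel"
  unfolding gauss_def by measurable

lemma gauss_1_std_normal: "gauss 1 x = complex_of_real (sqrt (2 * pi) * std_normal_density x)"
  by (simp add: gauss_def std_normal_density_def)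

lemma integrable_gauss:
  assumes "0 < a"
  shows "integrable lborel (gauss a)"
proof -
  have "integrable lborel (\<lambda>x. complex_of_real (sqrt (2 * pi) * std_normal_density x))"
    using integrable_std_normal_moment[of 0] by (intro integrable_of_real integrable_mult_right) simp
  then have "integrable lborel (gauss 1)"
    by (simp add: gauss_1_std_normal[abs_def])
  then have "integrable lborel (\<lambda>x. gauss 1 (0 + sqrt a * x))"
    using assms by (intro lborel_integrable_real_affine) auto
  moreover have "(\<lambda>x. gauss 1 (0 + sqrt a * x)) = gauss a"
    using assms by (auto simp: gauss_def power_mult_distrib)
  ultimately show ?thesis by simp
qed

text \<open>This is the characteristic function of the standard normal distribution, up to the
  density's normalisation sqrt(2\<pi>) and a reflection that evenness absorbs.\<close>

lemma ft_gauss_1: "ft (gauss 1) t = complex_of_real (sqrt (2 * pi)) * gauss 1 t"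
proof -
  have "gauss 1 t = char std_normal_distribution (-t)"
    by (simp add: char_std_normal_distribution gauss_def)
  also have "\<dots> = (\<integral>x. std_normal_density x *\<^sub>R iexp (-t * x) \<partial>lborel)"
    unfolding char_def by (intro integral_density) (auto simp: normal_density_nonneg)
  finally have "complex_of_real (sqrt (2 * pi)) * gauss 1 t
      = (\<integral>x. complex_of_real (sqrt (2 * pi)) * (std_normal_density x *\<^sub>R iexp (-t * x)) \<partial>lborel)"
    by (simp only: integral_mult_right_zero)
  also have "\<dots> = ft (gauss 1) t"
    unfolding ft_def gauss_1_std_normal
    by (intro Bochner_Integration.integral_cong refl) (simp add: scaleR_conv_of_real mult_ac)
  finally show ?thesis ..
qed

lemma ft_gauss:
  assumes "0 < a"
  shows "ft (gauss a) t = complex_of_real (sqrt (2 * pi / a)) * gauss (1 / a) t"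
proof -
  have "complex_of_real (sqrt (2 * pi)) * gauss 1 (t / sqrt a) = ft (gauss 1) (t / sqrt a)"
    by (simp add: ft_gauss_1)
  also have "\<dots> = \<bar>sqrt a\<bar> *\<^sub>R (\<integral>x. gauss 1 (0 + sqrt a * x)
      * exp (- \<i> * complex_of_real (t / sqrt a) * complex_of_real (0 + sqrt a * x)) \<partial>lborel)"
    unfolding ft_def using assms by (intro lborel_integral_real_affine) simp
  also have "(\<integral>x. gauss 1 (0 + sqrt a * x)
      * exp (- \<i> * complex_of_real (t / sqrt a) * complex_of_real (0 + sqrt a * x)) \<partial>lborel) = ft (gauss a) t"
    unfolding ft_def
  proof (intro Bochner_Integration.integral_cong refl)
    fix x
    have "complex_of_real (t / sqrt a) * complex_of_real (0 + sqrt a * x) = complex_of_real t * complex_of_real x"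
    proof -
      have "t / sqrt a * (0 + sqrt a * x) = t * x" using assms by simp
      then show ?thesis by (metis of_real_mult)
    qed
    then have "- \<i> * complex_of_real (t / sqrt a) * complex_of_real (0 + sqrt a * x) = - \<i> * complex_of_real t * complex_of_real x"
      by (metis mult.assoc)
    then show "gauss 1 (0 + sqrt a * x)
      * exp (- \<i> * complex_of_real (t / sqrt a) * complex_of_real (0 + sqrt a * x))
      = gauss a x * exp (- \<i> * complex_of_real t * complex_of_real x)"
      using assms by (simp add: gauss_def power_mult_distrib mult.assoc)
  qed
  finally have "complex_of_real (sqrt a) * ft (gauss a) t = complex_of_real (sqrt (2 * pi)) * gauss (1 / a) t"
    using assms by (simp add: scaleR_conv_of_real gauss_def power_divide)
  then show ?thesis
    using assms by (simp add: field_simps real_sqrt_divide)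
qed

lemma ft_modulate: "ft (\<lambda>\<omega>. h \<omega> * exp (\<i> * complex_of_real s * complex_of_real \<omega>)) t = ft h (t - s)"
  unfolding ft_def by (intro Bochner_Integration.integral_cong refl)
    (simp add: mult.assoc exp_add[symmetric] algebra_simps)

lemma borel_measurable_ft [measurable]:
  assumes [measurable]: "h \<in> borel_measurable borel"
  shows "ft h \<in> borel_measurable borel"
proof -
  have "(\<lambda>\<omega>. \<integral>t. h t * exp (- \<i> * complex_of_real \<omega> * complex_of_real t) \<partial>lborel) \<in> borel_measurable borel"
    by (rule lborel.borel_measurable_lebesgue_integral) measurable
  then show ?thesis by (simp add: ft_def[abs_def])
qed

lemma norm_ft_le:
  shows "norm (ft h \<omega>) \<le> (\<integral>t. norm (h t) \<partial>lborel)"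
proof -
  have "norm (ft h \<omega>) \<le> (\<integral>t. norm (h t * exp (- \<i> * complex_of_real \<omega> * complex_of_real t)) \<partial>lborel)"
    unfolding ft_def by (rule integral_norm_bound)
  then show ?thesis by (simp add: norm_mult)
qed

text \<open>Both sides are iterated forms of one absolutely convergent double integral, the kernel
  e^(-i\<omega>t) being symmetric in \<omega> and t.\<close>

lemma ft_multiplication_formula:
  assumes h: "integrable lborel h" and k: "integrable lborel k"
  shows "(\<integral>\<omega>. ft h \<omega> * k \<omega> \<partial>lborel) = (\<integral>t. h t * ft k t \<partial>lborel)"
proof -
  have [measurable]: "h \<in> borel_measurable borel" "k \<in> borel_measurable borel"
    using h k by auto
  let ?F = "\<lambda>t \<omega>. h t * k \<omega> * exp (- \<i> * complex_of_real \<omega> * complex_of_real t)"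
  have "integrable (lborel \<Otimes>\<^sub>M lborel) (\<lambda>(t, \<omega>). ?F t \<omega>)"
  proof (rule lborel_pair.Fubini_integrable)
    show "(\<lambda>(t, \<omega>). ?F t \<omega>) \<in> borel_measurable (lborel \<Otimes>\<^sub>M lborel)" by measurable
    show "integrable lborel (\<lambda>t. \<integral>\<omega>. norm (case (t, \<omega>) of (t, \<omega>) \<Rightarrow> ?F t \<omega>) \<partial>lborel)"
      using h by (simp add: norm_mult)
    show "AE t in lborel. integrable lborel (\<lambda>\<omega>. case (t, \<omega>) of (t, \<omega>) \<Rightarrow> ?F t \<omega>)"
    proof (rule AE_I2)
      fix t
      have "integrable lborel (\<lambda>\<omega>. h t * (k \<omega> * exp (- \<i> * complex_of_real t * complex_of_real \<omega>)))"
        by (intro integrable_mult_right integrable_ft k)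
      then show "integrable lborel (\<lambda>\<omega>. case (t, \<omega>) of (t, \<omega>) \<Rightarrow> ?F t \<omega>)"
        by (simp add: mult_ac)
    qed
  qed
  then have "(\<integral>\<omega>. (\<integral>t. ?F t \<omega> \<partial>lborel) \<partial>lborel) = (\<integral>t. (\<integral>\<omega>. ?F t \<omega> \<partial>lborel) \<partial>lborel)"
    by (rule lborel_pair.Fubini_integral)
  also have "(\<integral>\<omega>. (\<integral>t. ?F t \<omega> \<partial>lborel) \<partial>lborel) = (\<integral>\<omega>. ft h \<omega> * k \<omega> \<partial>lborel)"
    unfolding ft_def by (simp add: mult_ac flip: integral_mult_left_zero integral_mult_right_zero)
  also have "(\<integral>t. (\<integral>\<omega>. ?F t \<omega> \<partial>lborel) \<partial>lborel) = (\<integral>t. h t * ft k t \<partial>lborel)"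
    unfolding ft_def by (simp add: mult_ac flip: integral_mult_left_zero integral_mult_right_zero)
  finally show ?thesis .
qed

text \<open>The transform of \<open>gauss a\<close> is positive, and inversion at 0 predicts the
  mass 2\<pi> \<open>gauss a 0\<close> = 2\<pi>. That this does not depend on a makes the bound
  below uniform in the weight.\<close>

lemma nn_integral_ft_gauss:
  assumes "0 < a"
  shows "(\<integral>\<^sup>+s. ennreal (norm (ft (gauss a) (s - t))) \<partial>lborel) = ennreal (2 * pi)"
proof -
  let ?g = "\<lambda>s. sqrt (2 * pi / a) * exp (- (s\<^sup>2 / a) / 2)"
  have n: "norm (ft (gauss a) s) = ?g s" for s
    using assms by (simp add: ft_gauss gauss_def norm_mult)
  have gi: "integrable lborel (gauss (1/a))" using assms by (intro integrable_gauss) simp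
  have i: "integrable lborel (\<lambda>s. exp (- (s\<^sup>2 / a) / 2))"
    using integrable_Re[OF gi] by (simp add: gauss_def)
  have v: "(\<integral>s. exp (- (s\<^sup>2 / a) / 2) \<partial>lborel) = sqrt (2 * pi * a)"
  proof -
    have "complex_of_real (\<integral>s. exp (- (s\<^sup>2 / a) / 2) \<partial>lborel) = ft (gauss (1/a)) 0"
      unfolding ft_def gauss_def by (simp flip: integral_complex_of_real)
    also have "\<dots> = complex_of_real (sqrt (2 * pi * a))"
      using assms by (subst ft_gauss) (auto simp: gauss_def)
    finally show ?thesis by (simp only: of_real_eq_iff)
  qed
  have "(\<integral>\<^sup>+s. ennreal (norm (ft (gauss a) (s - t))) \<partial>lborel) = (\<integral>\<^sup>+s. ennreal (norm (ft (gauss a) s)) \<partial>lborel)"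
    by (subst nn_integral_real_affine[of _ 1 "-t"]) (auto simp: algebra_simps)
  also have "\<dots> = (\<integral>\<^sup>+s. ennreal (?g s) \<partial>lborel)" by (simp only: n)
  also have "\<dots> = ennreal (\<integral>s. ?g s \<partial>lborel)"
    using assms i by (intro nn_integral_eq_integral) auto
  also have "(\<integral>s. ?g s \<partial>lborel) = sqrt (2 * pi / a) * sqrt (2 * pi * a)"
    using v by simp
  also have "\<dots> = 2 * pi"
  proof -
    have "2 * pi / a * (2 * pi * a) = (2 * pi)\<^sup>2"
      using assms by (simp add: field_simps power2_eq_square)
    then show ?thesis by (metis real_sqrt_mult real_sqrt_abs abs_of_nonneg mult_nonneg_nonneg pi_ge_zero zero_le_numeral)
  qed
  finally show ?thesis .
qed

section \<open>The mean square bound for the Fourier transform\<close>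

lemma integrable_ft_mult_bounded:
  assumes "integrable lborel h" "integrable lborel k"
  shows "integrable lborel (\<lambda>\<omega>. ft h \<omega> * k \<omega>)"
proof (rule Bochner_Integration.integrable_bound)
  show "integrable lborel (\<lambda>\<omega>. (\<integral>t. norm (h t) \<partial>lborel) * k \<omega>)"
    by (intro integrable_mult_right assms)
  have "h \<in> borel_measurable borel" "k \<in> borel_measurable borel" using assms by auto
  then show "(\<lambda>\<omega>. ft h \<omega> * k \<omega>) \<in> borel_measurable lborel" by measurable
  show "AE \<omega> in lborel. norm (ft h \<omega> * k \<omega>) \<le> norm ((\<integral>t. norm (h t) \<partial>lborel) * k \<omega>)"
    unfolding norm_mult by (intro AE_I2 mult_right_mono) (auto intro: norm_ft_le)
qed

text \<open>Expanding the left-hand side as a double integral of \<open>h(t) cnj(h(s))\<close> against the transform of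
  the Gaussian, a positive kernel of mass \<open>2\<pi>\<close>, reduces the claim to AM-GM and Tonelli.\<close>

lemma nn_integral_ft_square_gauss_le:
  assumes a: "0 < a" and h: "integrable lborel h"
  shows "(\<integral>\<^sup>+\<omega>. ennreal ((norm (ft h \<omega>))\<^sup>2 * exp (- (a * \<omega>\<^sup>2) / 2)) \<partial>lborel) \<le> ennreal (2 * pi) * sqnorm h"
proof -
  have [measurable]: "h \<in> borel_measurable borel" using h by auto
  define \<Gamma> where "\<Gamma> = ft (gauss a)"
  have [measurable]: "\<Gamma> \<in> borel_measurable borel" unfolding \<Gamma>_def by measurable
  have \<Gamma>_even: "\<Gamma> (t - s) = \<Gamma> (s - t)" for s t
    unfolding \<Gamma>_def using a by (simp add: ft_gauss gauss_def power2_commute)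
  \<comment> \<open>With this k, \<open>ft h \<omega> * k \<omega>\<close> is the weighted square to
    be estimated, and the multiplication formula moves the transform from h to k.\<close>
  define k where "k \<omega> = cnj (ft h \<omega>) * gauss a \<omega>" for \<omega>
  have cm: "(\<lambda>\<omega>. cnj (ft h \<omega>)) \<in> borel_measurable borel"
    by (rule borel_measurable_continuous_on[of cnj]) (auto intro: continuous_on_cnj)
  have k: "integrable lborel k"
  proof (rule Bochner_Integration.integrable_bound)
    show "integrable lborel (\<lambda>\<omega>. (\<integral>t. norm (h t) \<partial>lborel) * gauss a \<omega>)"
      by (intro integrable_mult_right integrable_gauss a)
    show "k \<in> borel_measurable lborel" unfolding k_def using cm by measurable
    show "AE \<omega> in lborel. norm (k \<omega>) \<le> norm ((\<integral>t. norm (h t) \<partial>lborel) * gauss a \<omega>)"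
      unfolding k_def norm_mult by (intro AE_I2 mult_right_mono) (auto intro: norm_ft_le)
  qed
  have ftk: "ft k t = cnj (\<integral>s. h s * \<Gamma> (s - t) \<partial>lborel)" for t
  proof -
    have gm: "integrable lborel (\<lambda>\<omega>. gauss a \<omega> * exp (\<i> * complex_of_real t * complex_of_real \<omega>))"
      using integrable_ft[OF integrable_gauss[OF a], of "-t"] by simp
    have "ft k t = (\<integral>\<omega>. cnj (ft h \<omega> * (gauss a \<omega> * exp (\<i> * complex_of_real t * complex_of_real \<omega>))) \<partial>lborel)"
      unfolding ft_def k_def by (simp add: exp_cnj gauss_def mult_ac)
    also have "\<dots> = cnj (\<integral>\<omega>. ft h \<omega> * (gauss a \<omega> * exp (\<i> * complex_of_real t * complex_of_real \<omega>)) \<partial>lborel)"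
      by (rule Bochner_Integration.integral_cnj)
    also have "\<dots> = cnj (\<integral>s. h s * ft (\<lambda>\<omega>. gauss a \<omega> * exp (\<i> * complex_of_real t * complex_of_real \<omega>)) s \<partial>lborel)"
      by (subst ft_multiplication_formula[OF h gm]) simp
    finally show ?thesis by (simp add: ft_modulate \<Gamma>_def)
  qed
  have ik: "integrable lborel (\<lambda>\<omega>. ft h \<omega> * k \<omega>)"
    by (rule integrable_ft_mult_bounded[OF h k])
  have e: "ft h \<omega> * k \<omega> = complex_of_real ((norm (ft h \<omega>))\<^sup>2 * exp (- (a * \<omega>\<^sup>2) / 2))" for \<omega>
    using complex_norm_square[of "ft h \<omega>"] unfolding k_def gauss_def by (simp add: mult_ac)
  have ir: "integrable lborel (\<lambda>\<omega>. (norm (ft h \<omega>))\<^sup>2 * exp (- (a * \<omega>\<^sup>2) / 2))"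
    using integrable_Re[OF ik] unfolding e by simp
  have "(\<integral>\<^sup>+\<omega>. ennreal ((norm (ft h \<omega>))\<^sup>2 * exp (- (a * \<omega>\<^sup>2) / 2)) \<partial>lborel)
      = ennreal (\<integral>\<omega>. (norm (ft h \<omega>))\<^sup>2 * exp (- (a * \<omega>\<^sup>2) / 2) \<partial>lborel)"
    by (intro nn_integral_eq_integral ir) auto
  also have "\<dots> \<le> ennreal (norm (\<integral>\<omega>. ft h \<omega> * k \<omega> \<partial>lborel))"
    unfolding e by (subst integral_complex_of_real) (auto intro!: ennreal_leI)
  also have "\<dots> = ennreal (norm (\<integral>t. h t * ft k t \<partial>lborel))"
    by (simp add: ft_multiplication_formula[OF h k])
  also have "\<dots> \<le> (\<integral>\<^sup>+t. norm (h t * ft k t) \<partial>lborel)"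
  proof (cases "integrable lborel (\<lambda>t. h t * ft k t)")
    case True then show ?thesis by (rule integral_norm_bound_ennreal)
  \<comment> \<open>Without integrability the Bochner integral is 0 by default, and the bound is
    trivial.\<close>
  qed (simp add: not_integrable_integral_eq)
  also have "\<dots> \<le> (\<integral>\<^sup>+t. (\<integral>\<^sup>+s. ennreal (norm (h t) * (norm (h s) * norm (\<Gamma> (s - t)))) \<partial>lborel) \<partial>lborel)"
  proof (rule nn_integral_mono)
    fix t
    have "ennreal (norm (ft k t)) \<le> (\<integral>\<^sup>+s. ennreal (norm (h s) * norm (\<Gamma> (s - t))) \<partial>lborel)"
    proof (cases "integrable lborel (\<lambda>s. h s * \<Gamma> (s - t))")
      case True
      from integral_norm_bound_ennreal[OF this] show ?thesis
        unfolding ftk by (simp add: norm_mult)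
    qed (simp add: ftk not_integrable_integral_eq)
    then have "ennreal (norm (h t)) * ennreal (norm (ft k t))
        \<le> ennreal (norm (h t)) * (\<integral>\<^sup>+s. ennreal (norm (h s) * norm (\<Gamma> (s - t))) \<partial>lborel)"
      by (rule mult_left_mono) simp
    also have "\<dots> = (\<integral>\<^sup>+s. ennreal (norm (h t) * (norm (h s) * norm (\<Gamma> (s - t)))) \<partial>lborel)"
      by (subst nn_integral_cmult[symmetric]) (auto simp: ennreal_mult')
    finally show "ennreal (norm (h t * ft k t)) \<le> (\<integral>\<^sup>+s. ennreal (norm (h t) * (norm (h s) * norm (\<Gamma> (s - t)))) \<partial>lborel)"
      by (simp add: norm_mult ennreal_mult')
  qed
  also have "\<dots> \<le> (\<integral>\<^sup>+t. (\<integral>\<^sup>+s. ennreal ((norm (h t))\<^sup>2 / 2) * ennreal (norm (\<Gamma> (s - t)))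
        + ennreal ((norm (h s))\<^sup>2 / 2) * ennreal (norm (\<Gamma> (s - t))) \<partial>lborel) \<partial>lborel)"
  proof (intro nn_integral_mono)
    fix t s
    have "norm (h t) * norm (h s) \<le> (norm (h t))\<^sup>2 / 2 + (norm (h s))\<^sup>2 / 2"
      using sum_squares_bound[of "norm (h t)" "norm (h s)"] by simp
    then have "norm (h t) * norm (h s) * norm (\<Gamma> (s - t))
        \<le> ((norm (h t))\<^sup>2 / 2 + (norm (h s))\<^sup>2 / 2) * norm (\<Gamma> (s - t))"
      by (rule mult_right_mono) simp
    then have "ennreal (norm (h t) * (norm (h s) * norm (\<Gamma> (s - t))))
        \<le> ennreal ((norm (h t))\<^sup>2 / 2 * norm (\<Gamma> (s - t)) + (norm (h s))\<^sup>2 / 2 * norm (\<Gamma> (s - t)))"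
      by (intro ennreal_leI) (simp only: distrib_right mult.assoc)
    then show "ennreal (norm (h t) * (norm (h s) * norm (\<Gamma> (s - t))))
        \<le> ennreal ((norm (h t))\<^sup>2 / 2) * ennreal (norm (\<Gamma> (s - t)))
          + ennreal ((norm (h s))\<^sup>2 / 2) * ennreal (norm (\<Gamma> (s - t)))"
      by (simp only: ennreal_plus ennreal_mult' mult_nonneg_nonneg norm_ge_zero zero_le_power2
          divide_nonneg_nonneg zero_le_numeral)
  qed
  also have "\<dots> = (\<integral>\<^sup>+t. (\<integral>\<^sup>+s. ennreal ((norm (h t))\<^sup>2 / 2) * ennreal (norm (\<Gamma> (s - t))) \<partial>lborel) \<partial>lborel)
      + (\<integral>\<^sup>+t. (\<integral>\<^sup>+s. ennreal ((norm (h s))\<^sup>2 / 2) * ennreal (norm (\<Gamma> (s - t))) \<partial>lborel) \<partial>lborel)"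
    by (simp add: nn_integral_add)
  \<comment> \<open>Exchanging the order of integration, with \<open>\<Gamma>\<close> even, turns
    the second half into the first with renamed variables.\<close>
  also have "(\<integral>\<^sup>+t. (\<integral>\<^sup>+s. ennreal ((norm (h s))\<^sup>2 / 2) * ennreal (norm (\<Gamma> (s - t))) \<partial>lborel) \<partial>lborel)
      = (\<integral>\<^sup>+s. (\<integral>\<^sup>+t. ennreal ((norm (h s))\<^sup>2 / 2) * ennreal (norm (\<Gamma> (t - s))) \<partial>lborel) \<partial>lborel)"
    by (subst lborel_pair.Fubini') (simp_all add: \<Gamma>_even)
  also have "(\<integral>\<^sup>+t. (\<integral>\<^sup>+s. ennreal ((norm (h t))\<^sup>2 / 2) * ennreal (norm (\<Gamma> (s - t))) \<partial>lborel) \<partial>lborel)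
      = (\<integral>\<^sup>+t. ennreal (2 * pi) * ennreal ((norm (h t))\<^sup>2 / 2) \<partial>lborel)"
    by (subst nn_integral_cmult) (simp_all add: nn_integral_ft_gauss[OF a] \<Gamma>_def mult.commute)
  also have "\<dots> = ennreal (2 * pi) * (\<integral>\<^sup>+t. ennreal ((norm (h t))\<^sup>2 / 2) \<partial>lborel)"
    by (rule nn_integral_cmult) simp
  also have "\<dots> + \<dots> = ennreal (2 * pi) * ((\<integral>\<^sup>+t. ennreal ((norm (h t))\<^sup>2 / 2) \<partial>lborel) + (\<integral>\<^sup>+t. ennreal ((norm (h t))\<^sup>2 / 2) \<partial>lborel))"
    by (simp add: distrib_left)
  also have "(\<integral>\<^sup>+t. ennreal ((norm (h t))\<^sup>2 / 2) \<partial>lborel) + (\<integral>\<^sup>+t. ennreal ((norm (h t))\<^sup>2 / 2) \<partial>lborel) = sqnorm h"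
    unfolding sqnorm_def by (subst nn_integral_add[symmetric]) (auto simp flip: ennreal_plus)
  finally show ?thesis .
qed

text \<open>The weighted bound is uniform in a, so Fatou's lemma along a = 1/(n+1) removes the
  weight.\<close>

lemma sqnorm_ft_le:
  assumes h: "integrable lborel h"
  shows "sqnorm (ft h) \<le> ennreal (2 * pi) * sqnorm h"
proof -
  have [measurable]: "h \<in> borel_measurable borel" using h by auto
  let ?f = "\<lambda>n \<omega>. ennreal ((norm (ft h \<omega>))\<^sup>2 * exp (- (1 / real (Suc n) * \<omega>\<^sup>2) / 2))"
  have "sqnorm (ft h) = (\<integral>\<^sup>+\<omega>. liminf (\<lambda>n. ?f n \<omega>) \<partial>lborel)"
    unfolding sqnorm_def
  proof (rule nn_integral_cong)
    fix \<omega>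
    have "(\<lambda>n. (norm (ft h \<omega>))\<^sup>2 * exp (- (1 / real (Suc n) * \<omega>\<^sup>2) / 2))
        \<longlonglongrightarrow> (norm (ft h \<omega>))\<^sup>2 * exp (- (0 * \<omega>\<^sup>2) / 2)"
      by (intro tendsto_intros LIMSEQ_Suc[OF lim_1_over_n]) auto
    then have "(\<lambda>n. ?f n \<omega>) \<longlonglongrightarrow> ennreal ((norm (ft h \<omega>))\<^sup>2)"
      by (intro tendsto_ennrealI) simp
    then show "ennreal ((norm (ft h \<omega>))\<^sup>2) = liminf (\<lambda>n. ?f n \<omega>)"
      by (rule lim_imp_Liminf[OF sequentially_bot, symmetric])
  qed
  also have "\<dots> \<le> liminf (\<lambda>n. \<integral>\<^sup>+\<omega>. ?f n \<omega> \<partial>lborel)"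
    by (rule nn_integral_liminf) measurable
  also have "\<dots> \<le> ennreal (2 * pi) * sqnorm h"
    by (intro Liminf_le always_eventually allI nn_integral_ft_square_gauss_le h) auto
  finally show ?thesis .
qed

section \<open>Fourier transform in mean square\<close>

definition trunc :: "real \<Rightarrow> (real \<Rightarrow> complex) \<Rightarrow> real \<Rightarrow> complex" where
  "trunc r f t = indicator {-r..r} t * f t"

lemma truncated_fourier_eq_ft: "truncated_fourier r f = ft (trunc r f)"
  unfolding truncated_fourier_def ft_def set_lebesgue_integral_def trunc_def
  by (intro ext Bochner_Integration.integral_cong refl) (simp split: split_indicator)

lemma trunc_measurable [measurable]:
  assumes [measurable]: "f \<in> borel_measurable borel"
  shows "trunc r f \<in> borel_measurable borel"
  unfolding trunc_def[abs_def] by measurable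

lemma square_integrable_trunc:
  assumes "square_integrable f" shows "square_integrable (trunc r f)"
proof -
  have [measurable]: "f \<in> borel_measurable borel"
    using assms by (rule square_integrable_measurable)
  show ?thesis
    by (rule square_integrable_mono[OF assms]) (auto simp: trunc_def split: split_indicator)
qed

lemma square_integrable_indicator_Icc: "square_integrable (indicator {a..b::real})"
proof -
  have "(\<lambda>t. (norm (indicator {a..b} t :: complex))\<^sup>2) = (indicator {a..b} :: real \<Rightarrow> real)"
    by (auto simp: fun_eq_iff split: split_indicator)
  then show ?thesis
    by (auto simp: square_integrable_def emeasure_lborel_Icc_eq intro!: integrable_real_indicator)
qed

lemma integrable_trunc:
  assumes "square_integrable f" shows "integrable lborel (trunc r f)"
  unfolding trunc_def[abs_def]
  by (rule square_integrable_imp_integrable_mult[OF square_integrable_indicator_Icc assms])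

text \<open>On a bounded interval L2 is contained in L1, by pairing with the indicator. This makes
  \<open>ft g\<close> an honest integral for every spectrum g that occurs.\<close>

lemma square_integrable_bounded_support_integrable:
  assumes g: "square_integrable g" and 0: "AE \<omega> in lborel. \<omega> \<notin> {-B..B} \<longrightarrow> g \<omega> = 0"
  shows "integrable lborel g"
proof -
  have [measurable]: "g \<in> borel_measurable borel"
    using g by (rule square_integrable_measurable)
  have "AE \<omega> in lborel. trunc B g \<omega> = g \<omega>"
    using 0 by eventually_elim (auto simp: trunc_def split: split_indicator)
  with integrable_trunc[OF g, of B] show ?thesis
    by (subst integrable_cong_AE[where g = "trunc B g"]) auto
qed

lemma sqnorm_diff_trunc_tendsto:
  assumes f: "square_integrable f"
  shows "((\<lambda>r. sqnorm (\<lambda>t. trunc r f t - f t)) \<longlongrightarrow> 0) at_top"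
proof -
  have [measurable]: "f \<in> borel_measurable borel"
    using f by (rule square_integrable_measurable)
  have "((\<lambda>r. \<integral>t. (norm (trunc r f t - f t))\<^sup>2 \<partial>lborel) \<longlongrightarrow> (\<integral>t. 0 \<partial>(lborel::real measure))) at_top"
  proof (rule integral_dominated_convergence_at_top)
    show "integrable lborel (\<lambda>t. (norm (f t))\<^sup>2)"
      using f by (simp add: square_integrable_def)
    show "\<forall>\<^sub>F r in at_top. AE t in lborel. norm ((norm (trunc r f t - f t))\<^sup>2) \<le> (norm (f t))\<^sup>2"
      by (intro always_eventually allI AE_I2) (auto simp: trunc_def split: split_indicator)
    show "AE t in lborel. ((\<lambda>r. (norm (trunc r f t - f t))\<^sup>2) \<longlongrightarrow> 0) at_top"
    proof (rule AE_I2)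
      fix t
      have "\<forall>\<^sub>F r in at_top. (norm (trunc r f t - f t))\<^sup>2 = 0"
        using eventually_ge_at_top[of "\<bar>t\<bar>"]
        by eventually_elim (auto simp: trunc_def split: split_indicator)
      then show "((\<lambda>r. (norm (trunc r f t - f t))\<^sup>2) \<longlongrightarrow> 0) at_top"
        by (simp add: tendsto_eventually)
    qed
  qed auto
  then have "((\<lambda>r. ennreal (\<integral>t. (norm (trunc r f t - f t))\<^sup>2 \<partial>lborel)) \<longlongrightarrow> ennreal 0) at_top"
    by (intro tendsto_ennrealI) simp
  then show ?thesis
    by (simp add: square_integrableD(3)[OF square_integrable_diff[OF square_integrable_trunc[OF f] f]])
qed

lemma ft_diff:
  assumes "integrable lborel h" "integrable lborel k"
  shows "ft (\<lambda>t. h t - k t) \<omega> = ft h \<omega> - ft k \<omega>"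
  unfolding ft_def by (simp only: left_diff_distrib
      Bochner_Integration.integral_diff[OF integrable_ft[OF assms(1)] integrable_ft[OF assms(2)]])

lemma square_integrable_ft:
  assumes "integrable lborel h" "square_integrable h"
  shows "square_integrable (ft h)"
proof -
  have [measurable]: "h \<in> borel_measurable borel" using assms by auto
  have "sqnorm (ft h) \<le> ennreal (2 * pi) * sqnorm h" by (rule sqnorm_ft_le) fact
  also have "\<dots> < \<infinity>"
    using square_integrableD(2)[OF assms(2)] by (auto simp: ennreal_mult_less_top)
  finally show ?thesis by (simp add: square_integrable_iff_sqnorm)
qed

lemma square_integrable_reflect:
  assumes "square_integrable f" shows "square_integrable (\<lambda>t. f (- t))"
proof -
  have [measurable]: "f \<in> borel_measurable borel"
    using assms by (rule square_integrable_measurable)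
  have "sqnorm (\<lambda>t. f (- t)) = sqnorm f"
    unfolding sqnorm_def by (subst (2) nn_integral_real_affine[of _ "-1" 0]) auto
  with assms show ?thesis by (simp add: square_integrable_iff_sqnorm)
qed

lemma square_integrable_gauss:
  assumes "0 < a" shows "square_integrable (gauss a)"
proof -
  have "integrable lborel (\<lambda>x. Re (gauss (2 * a) x))"
    using assms by (intro integrable_Re integrable_gauss) simp
  moreover have "(norm (gauss a x))\<^sup>2 = Re (gauss (2 * a) x)" for x
    by (simp add: gauss_def power2_eq_square flip: exp_add)
  ultimately show ?thesis by (simp add: square_integrable_def)
qed

section \<open>Gaussian test functions and inversion in mean square\<close>

text \<open>Reflecting t moves the sign onto the test function; the multiplication formula then
  leaves the double transform of k, which inversion evaluates. Inversion is asked of k alone, so it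
  has to be verified only for explicit test functions.\<close>

lemma integral_inverse_ft_mult_ft:
  assumes g: "integrable lborel g" and k: "integrable lborel (\<lambda>t. ft k (- t))"
    and inv: "\<And>\<omega>. ft (\<lambda>t. ft k (- t)) \<omega> = complex_of_real (2 * pi) * k \<omega>"
  shows "(\<integral>t. ft g (- t) / complex_of_real (2 * pi) * ft k t \<partial>lborel) = (\<integral>\<omega>. g \<omega> * k \<omega> \<partial>lborel)"
proof -
  have "(\<integral>t. ft g (- t) / complex_of_real (2 * pi) * ft k t \<partial>lborel)
      = (\<integral>t. ft g t * ft k (- t) / complex_of_real (2 * pi) \<partial>lborel)"
    by (subst lborel_integral_real_affine[of "-1" _ 0]) simp_all
  also have "\<dots> = (\<integral>t. ft g t * ft k (- t) \<partial>lborel) / complex_of_real (2 * pi)"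
    by (rule integral_divide_zero)
  also have "(\<integral>t. ft g t * ft k (- t) \<partial>lborel) = (\<integral>\<omega>. g \<omega> * (complex_of_real (2 * pi) * k \<omega>) \<partial>lborel)"
    by (subst ft_multiplication_formula[OF g k]) (simp only: inv)
  also have "\<dots> = (\<integral>\<omega>. complex_of_real (2 * pi) * (g \<omega> * k \<omega>) \<partial>lborel)"
    by (simp only: mult.left_commute)
  also have "\<dots> = complex_of_real (2 * pi) * (\<integral>\<omega>. g \<omega> * k \<omega> \<partial>lborel)"
    by (rule integral_mult_right_zero)
  finally show ?thesis by simp
qed

lemma ft_cmult: "ft (\<lambda>t. c * h t) \<omega> = c * ft h \<omega>"
  unfolding ft_def mult.assoc by (rule integral_mult_right_zero)

lemma ft_translate: "ft (\<lambda>t. h (t - y)) \<omega> = ft h \<omega> * exp (\<i> * complex_of_real (- y) * complex_of_real \<omega>)"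
proof -
  have "ft (\<lambda>t. h (t - y)) \<omega> = (\<integral>t. h t * exp (- \<i> * complex_of_real \<omega> * complex_of_real t)
      * exp (\<i> * complex_of_real (- y) * complex_of_real \<omega>) \<partial>lborel)"
    unfolding ft_def
    by (subst lborel_integral_real_affine[of 1 _ y])
       (simp_all add: mult.assoc algebra_simps flip: exp_add)
  also have "\<dots> = ft h \<omega> * exp (\<i> * complex_of_real (- y) * complex_of_real \<omega>)"
    unfolding ft_def by (rule integral_mult_left_zero)
  finally show ?thesis .
qed

text \<open>A modulated Gaussian. Integrating a function against all waves computes the Fourier
  transform of its product with \<open>gauss 1\<close>, which is integrable as soon as the function
  is square integrable.\<close>

definition wave :: "real \<Rightarrow> real \<Rightarrow> complex" where
  "wave s \<omega> = gauss 1 \<omega> * exp (\<i> * complex_of_real s * complex_of_real \<omega>)"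

lemma integrable_wave: "integrable lborel (wave s)"
  using integrable_ft[OF integrable_gauss[of 1], of "-s"] by (simp add: wave_def[abs_def])

lemma square_integrable_wave: "square_integrable (wave s)"
  unfolding wave_def[abs_def]
  by (rule square_integrable_mono[OF square_integrable_gauss[of 1]]) (auto simp: norm_mult)

lemma ft_wave: "ft (wave s) t = complex_of_real (sqrt (2 * pi)) * gauss 1 (t - s)"
  by (simp add: wave_def[abs_def] ft_modulate ft_gauss_1)

lemma ft_translate_gauss: "ft (\<lambda>\<omega>. gauss 1 (\<omega> - y)) t = complex_of_real (sqrt (2 * pi)) * wave (- y) t"
  unfolding ft_translate ft_gauss_1 wave_def by simp

lemma integrable_translate_gauss: "integrable lborel (\<lambda>t. gauss 1 (t - y))"
  using lborel_integrable_real_affine[OF integrable_gauss[of 1], of 1 "-y"] by simp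

lemma square_integrable_translate_gauss: "square_integrable (\<lambda>t. gauss 1 (t - y))"
proof -
  have "integrable lborel (\<lambda>t. (norm (gauss 1 (- y + 1 * t)))\<^sup>2)"
    using square_integrableD(1)[OF square_integrable_gauss[of 1]]
    by (intro lborel_integrable_real_affine) auto
  then show ?thesis by (simp add: square_integrable_def)
qed

lemma sqrt_2pi_sq: "complex_of_real (sqrt (2 * pi)) * (complex_of_real (sqrt (2 * pi)) * z) = complex_of_real (2 * pi) * z"
  by (simp add: mult.assoc[symmetric] flip: of_real_mult)

lemma gauss_even: "gauss a (- x) = gauss a x"
  by (simp add: gauss_def)

text \<open>One transform leads from a wave to a translated Gaussian and the next one back; each
  contributes sqrt(2\<pi>), together 2\<pi>.\<close>

lemma wave_inversion:
  "integrable lborel (\<lambda>t. ft (wave s) (- t))"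
  "ft (\<lambda>t. ft (wave s) (- t)) \<omega> = complex_of_real (2 * pi) * wave s \<omega>"
proof -
  have e: "ft (wave s) (- t) = complex_of_real (sqrt (2 * pi)) * gauss 1 (t - (- s))" for t
    unfolding ft_wave using gauss_even[of 1 "t + s"] by simp
  show "integrable lborel (\<lambda>t. ft (wave s) (- t))"
    unfolding e by (intro integrable_mult_right integrable_translate_gauss)
  show "ft (\<lambda>t. ft (wave s) (- t)) \<omega> = complex_of_real (2 * pi) * wave s \<omega>"
    unfolding e ft_cmult ft_translate_gauss sqrt_2pi_sq by simp
qed

lemma translate_gauss_inversion:
  "integrable lborel (\<lambda>t. ft (\<lambda>\<omega>. gauss 1 (\<omega> - y)) (- t))"
  "ft (\<lambda>t. ft (\<lambda>\<omega>. gauss 1 (\<omega> - y)) (- t)) \<omega> = complex_of_real (2 * pi) * gauss 1 (\<omega> - y)"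
proof -
  have e: "ft (\<lambda>\<omega>. gauss 1 (\<omega> - y)) (- t) = complex_of_real (sqrt (2 * pi)) * wave y t" for t
    unfolding ft_translate_gauss by (simp add: wave_def gauss_even)
  show "integrable lborel (\<lambda>t. ft (\<lambda>\<omega>. gauss 1 (\<omega> - y)) (- t))"
    unfolding e by (intro integrable_mult_right integrable_wave)
  show "ft (\<lambda>t. ft (\<lambda>\<omega>. gauss 1 (\<omega> - y)) (- t)) \<omega> = complex_of_real (2 * pi) * gauss 1 (\<omega> - y)"
    unfolding e ft_cmult ft_wave sqrt_2pi_sq by simp
qed

text \<open>The bound \<open>sqnorm_ft_le\<close> makes the transforms of the truncations of f a
  Cauchy family in L2. Their limit G is identified with g by testing both against waves.\<close>

lemma has_L2_fourier_inverse_ft: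
  assumes g: "square_integrable g" and 0: "AE \<omega> in lborel. \<omega> \<notin> {-B..B} \<longrightarrow> g \<omega> = 0"
  shows "has_L2_fourier (\<lambda>t. ft g (- t) / complex_of_real (2 * pi)) g"
proof -
  define f where "f t = ft g (- t) / complex_of_real (2 * pi)" for t
  have gi: "integrable lborel g"
    by (rule square_integrable_bounded_support_integrable[OF g 0])
  have f: "square_integrable f"
    using square_integrable_cmult[OF square_integrable_reflect[OF square_integrable_ft[OF gi g]], of "1 / complex_of_real (2 * pi)"]
    by (simp add: f_def[abs_def])
  have [measurable]: "f \<in> borel_measurable borel"
    using f by (rule square_integrable_measurable)
  define T where "T r = sqnorm (\<lambda>t. trunc r f t - f t)" for r
  have T: "(T \<longlongrightarrow> 0) at_top"
    unfolding T_def[abs_def] by (rule sqnorm_diff_trunc_tendsto[OF f])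
  define u where "u r = ft (trunc r f)" for r
  have u: "square_integrable (u r)" for r
    unfolding u_def by (intro square_integrable_ft integrable_trunc square_integrable_trunc f)
  have [measurable]: "u r \<in> borel_measurable borel" for r
    using u by (rule square_integrable_measurable)
  \<comment> \<open>The two truncations agree up to radius \<open>min r s\<close>, so their
    difference is dominated by the tail of f beyond it.\<close>
  have diff: "sqnorm (\<lambda>\<omega>. u r \<omega> - u s \<omega>) \<le> ennreal (2 * pi) * T (min r s)" for r s
  proof -
    have "sqnorm (\<lambda>\<omega>. u r \<omega> - u s \<omega>) = sqnorm (ft (\<lambda>t. trunc r f t - trunc s f t))"
      unfolding u_def by (simp add: ft_diff[OF integrable_trunc[OF f] integrable_trunc[OF f], abs_def])
    also have "\<dots> \<le> ennreal (2 * pi) * sqnorm (\<lambda>t. trunc r f t - trunc s f t)"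
      by (intro sqnorm_ft_le Bochner_Integration.integrable_diff integrable_trunc f)
    also have "\<dots> \<le> ennreal (2 * pi) * T (min r s)"
      unfolding T_def
      by (intro mult_left_mono sqnorm_mono AE_I2) (auto simp: trunc_def split: split_indicator)
    finally show ?thesis .
  qed
  have T2: "((\<lambda>r. ennreal (2 * pi) * T r) \<longlongrightarrow> 0) at_top"
    using ennreal_tendsto_cmult[OF _ T, of "ennreal (2 * pi)"] by simp
  obtain G where G: "square_integrable G" and lim: "(\<lambda>n. sqnorm (\<lambda>\<omega>. u (real n) \<omega> - G \<omega>)) \<longlonglongrightarrow> 0"
  proof (rule L2_complete[of "\<lambda>n. u (real n)"])
    fix e :: real assume "0 < e"
    with order_tendstoD(2)[OF T2, of "ennreal e"] obtain R where R: "\<And>r. R \<le> r \<Longrightarrow> ennreal (2 * pi) * T r < ennreal e"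
      by (auto simp: eventually_at_top_linorder)
    obtain N :: nat where "R \<le> real N" using real_arch_simple by blast
    have "\<forall>m\<ge>N. \<forall>n\<ge>N. sqnorm (\<lambda>x. u (real m) x - u (real n) x) \<le> ennreal e"
    proof (intro allI impI)
      fix m n assume "N \<le> m" "N \<le> n"
      with \<open>R \<le> real N\<close> have "R \<le> min (real m) (real n)" by simp
      from diff[of "real m" "real n"] R[OF this] show "sqnorm (\<lambda>x. u (real m) x - u (real n) x) \<le> ennreal e"
        by (meson le_less_trans less_imp_le)
    qed
    then show "\<exists>N. \<forall>m\<ge>N. \<forall>n\<ge>N. sqnorm (\<lambda>x. u (real m) x - u (real n) x) \<le> ennreal e" ..
  qed (use u in auto)
  have [measurable]: "G \<in> borel_measurable borel" "g \<in> borel_measurable borel"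
    using G g by (auto intro: square_integrable_measurable)
  \<comment> \<open>The multiplication formula moves the transform to the wave, where the truncation
    can be released because \<open>ft (wave s)\<close> is square integrable.\<close>
  have Gt: "(\<integral>\<omega>. G \<omega> * wave s \<omega> \<partial>lborel) = (\<integral>\<omega>. g \<omega> * wave s \<omega> \<partial>lborel)" for s
  proof -
    have "(\<lambda>n. \<integral>\<omega>. u (real n) \<omega> * wave s \<omega> \<partial>lborel) \<longlonglongrightarrow> (\<integral>\<omega>. G \<omega> * wave s \<omega> \<partial>lborel)"
      by (rule tendsto_integral_mult_L2[OF u G square_integrable_wave lim])
    moreover have "(\<integral>\<omega>. u (real n) \<omega> * wave s \<omega> \<partial>lborel) = (\<integral>t. trunc (real n) f t * ft (wave s) t \<partial>lborel)" for n
      unfolding u_def by (intro ft_multiplication_formula integrable_trunc f integrable_wave)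
    moreover have "(\<lambda>n. \<integral>t. trunc (real n) f t * ft (wave s) t \<partial>lborel) \<longlonglongrightarrow> (\<integral>t. f t * ft (wave s) t \<partial>lborel)"
      by (rule tendsto_integral_mult_L2[OF square_integrable_trunc[OF f] f
            square_integrable_ft[OF integrable_wave square_integrable_wave]
            filterlim_compose[OF sqnorm_diff_trunc_tendsto[OF f] filterlim_real_sequentially]])
    ultimately have "(\<integral>\<omega>. G \<omega> * wave s \<omega> \<partial>lborel) = (\<integral>t. f t * ft (wave s) t \<partial>lborel)"
      using LIMSEQ_unique by simp
    also have "\<dots> = (\<integral>\<omega>. g \<omega> * wave s \<omega> \<partial>lborel)"
      unfolding f_def by (rule integral_inverse_ft_mult_ft[OF gi wave_inversion])
    finally show ?thesis .
  qed
  have "AE \<omega> in lborel. (G \<omega> - g \<omega>) * gauss 1 \<omega> = 0"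
  proof (rule ft_eq_0_imp_AE_0)
    show "integrable lborel (\<lambda>\<omega>. (G \<omega> - g \<omega>) * gauss 1 \<omega>)"
      by (intro square_integrable_imp_integrable_mult square_integrable_diff G g square_integrable_gauss) simp
    fix s
    have "ft (\<lambda>\<omega>. (G \<omega> - g \<omega>) * gauss 1 \<omega>) s = (\<integral>\<omega>. G \<omega> * wave (- s) \<omega> - g \<omega> * wave (- s) \<omega> \<partial>lborel)"
      unfolding ft_def wave_def
      by (intro Bochner_Integration.integral_cong refl) (simp add: algebra_simps)
    also have "\<dots> = 0"
      by (subst Bochner_Integration.integral_diff)
         (auto intro!: square_integrable_imp_integrable_mult G g square_integrable_wave simp: Gt)
    finally show "ft (\<lambda>\<omega>. (G \<omega> - g \<omega>) * gauss 1 \<omega>) s = 0" .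
  qed
  then have Gg: "AE \<omega> in lborel. G \<omega> = g \<omega>"
    by eventually_elim (simp add: gauss_def)
  \<comment> \<open>Completeness gives convergence along integer radii only. For a real radius r,
    comparison with a large integer n adds an error term in n, and letting n grow removes
    it.\<close>
  have bound: "sqnorm (\<lambda>\<omega>. g \<omega> - u r \<omega>) \<le> 2 * (ennreal (2 * pi) * T r)" for r
  proof -
    have "sqnorm (\<lambda>\<omega>. g \<omega> - u r \<omega>) = sqnorm (\<lambda>\<omega>. u r \<omega> - G \<omega>)"
      unfolding sqnorm_minus_commute[of g] using Gg by (intro sqnorm_cong_AE) auto
    also have "\<dots> \<le> 2 * (ennreal (2 * pi) * T r)"
    proof (rule tendsto_lowerbound)
      have "(\<lambda>n. 2 * (ennreal (2 * pi) * T r) + 2 * sqnorm (\<lambda>\<omega>. u (real n) \<omega> - G \<omega>))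
          \<longlonglongrightarrow> 2 * (ennreal (2 * pi) * T r) + 2 * 0"
        by (intro tendsto_add tendsto_const ennreal_tendsto_cmult lim) simp
      then show "(\<lambda>n. 2 * (ennreal (2 * pi) * T r) + 2 * sqnorm (\<lambda>\<omega>. u (real n) \<omega> - G \<omega>))
          \<longlonglongrightarrow> 2 * (ennreal (2 * pi) * T r)" by simp
      obtain N :: nat where N: "r \<le> real N" using real_arch_simple by blast
      show "\<forall>\<^sub>F n in sequentially. sqnorm (\<lambda>\<omega>. u r \<omega> - G \<omega>)
          \<le> 2 * (ennreal (2 * pi) * T r) + 2 * sqnorm (\<lambda>\<omega>. u (real n) \<omega> - G \<omega>)"
        using eventually_ge_at_top[of N]
      proof eventually_elim
        case (elim n)
        with N have "min r (real n) = r" by simp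
        then have d: "sqnorm (\<lambda>\<omega>. u r \<omega> - u (real n) \<omega>) \<le> ennreal (2 * pi) * T r"
          using diff[of r "real n"] by simp
        have "sqnorm (\<lambda>\<omega>. u r \<omega> - G \<omega>)
            = sqnorm (\<lambda>\<omega>. (u r \<omega> - u (real n) \<omega>) + (u (real n) \<omega> - G \<omega>))" by simp
        also have "\<dots> \<le> 2 * sqnorm (\<lambda>\<omega>. u r \<omega> - u (real n) \<omega>) + 2 * sqnorm (\<lambda>\<omega>. u (real n) \<omega> - G \<omega>)"
          by (rule sqnorm_add_le) auto
        also have "\<dots> \<le> 2 * (ennreal (2 * pi) * T r) + 2 * sqnorm (\<lambda>\<omega>. u (real n) \<omega> - G \<omega>)"
          by (intro add_mono mult_left_mono d order.refl) simp
        finally show ?case .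
      qed
    qed simp
    finally show ?thesis .
  qed
  have "((\<lambda>r. 2 * (ennreal (2 * pi) * T r)) \<longlongrightarrow> 0) at_top"
    using ennreal_tendsto_cmult[OF _ T2, of 2] by simp
  then have "((\<lambda>r. sqnorm (\<lambda>\<omega>. g \<omega> - u r \<omega>)) \<longlongrightarrow> 0) at_top"
    by (rule tendsto_ennreal_0_sandwich) (rule bound)
  with f g show ?thesis
    unfolding has_L2_fourier_def f_def[abs_def, symmetric]
    by (simp add: truncated_fourier_eq_ft sqnorm_def u_def)
qed

lemma continuous_ft:
  assumes h: "integrable lborel h"
  shows "continuous_on UNIV (ft h)"
proof -
  have [measurable]: "h \<in> borel_measurable borel" using h by auto
  have "(\<lambda>n. ft h (X n)) \<longlonglongrightarrow> ft h x" if "X \<longlonglongrightarrow> x" for X x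
    unfolding ft_def
  proof (rule integral_dominated_convergence)
    show "integrable lborel (\<lambda>t. norm (h t))" using h by simp
    show "AE t in lborel. (\<lambda>i. h t * exp (- \<i> * complex_of_real (X i) * complex_of_real t))
        \<longlonglongrightarrow> h t * exp (- \<i> * complex_of_real x * complex_of_real t)"
      by (intro AE_I2 tendsto_intros that)
  qed (auto simp: norm_mult)
  then show ?thesis
    by (auto simp: continuous_on_sequentially comp_def)
qed

text \<open>The set of disagreement is open, and a nonempty open set contains an interval of
  positive measure.\<close>

lemma continuous_AE_eq_imp_eq:
  fixes f g :: "real \<Rightarrow> complex"
  assumes "continuous_on UNIV f" "continuous_on UNIV g" "AE x in lborel. f x = g x"
  shows "f x = g x"
proof (rule ccontr)
  assume "f x \<noteq> g x"
  let ?S = "{x. f x \<noteq> g x}"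
  have op: "open ?S"
    using assms by (intro open_Collect_neq) auto
  have "?S \<in> null_sets lborel"
    using assms(3) op by (subst AE_iff_null_sets) auto
  moreover obtain e where "0 < e" "{x - e..x + e} \<subseteq> ?S"
    using op \<open>f x \<noteq> g x\<close> unfolding open_contains_cball
    by (metis (mono_tags, lifting) cball_eq_atLeastAtMost mem_Collect_eq)
  ultimately have "emeasure lborel {x - e..x + e} = 0"
    using null_sets_subset[of ?S lborel "{x - e..x + e}"] by auto
  with \<open>0 < e\<close> show False by simp
qed

text \<open>The mirror image of \<open>has_L2_fourier_inverse_ft\<close>: g is given as the limit
  and f is to be recovered. Testing the limit against translated Gaussians in frequency amounts to
  testing f and the inverse transform of g against waves in time. This gives equality almost
  everywhere, and continuity makes it hold everywhere.\<close>

lemma has_L2_fourier_imp_eq_inverse_ft: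
  assumes fg: "has_L2_fourier f g" and cont: "continuous_on UNIV f"
    and 0: "AE \<omega> in lborel. \<omega> \<notin> {-B..B} \<longrightarrow> g \<omega> = 0"
  shows "f t = ft g (- t) / complex_of_real (2 * pi)"
proof -
  define F where "F t = ft g (- t) / complex_of_real (2 * pi)" for t
  have f: "square_integrable f" and g: "square_integrable g"
    using fg by (auto simp: has_L2_fourier_def)
  have gi: "integrable lborel g"
    by (rule square_integrable_bounded_support_integrable[OF g 0])
  have F: "square_integrable F"
    using has_L2_fourier_inverse_ft[OF g 0] by (simp add: has_L2_fourier_def F_def[abs_def])
  have lim: "((\<lambda>r. sqnorm (\<lambda>\<omega>. ft (trunc r f) \<omega> - g \<omega>)) \<longlongrightarrow> 0) at_top"
    unfolding sqnorm_minus_commute[of _ g]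
    using fg by (simp add: has_L2_fourier_def sqnorm_def truncated_fourier_eq_ft)
  have eq: "(\<integral>t. f t * wave (- y) t \<partial>lborel) = (\<integral>t. F t * wave (- y) t \<partial>lborel)" for y
  proof -
    let ?k = "\<lambda>\<omega>. gauss 1 (\<omega> - y)"
    have "((\<lambda>r. \<integral>\<omega>. ft (trunc r f) \<omega> * ?k \<omega> \<partial>lborel) \<longlongrightarrow> (\<integral>\<omega>. g \<omega> * ?k \<omega> \<partial>lborel)) at_top"
      by (rule tendsto_integral_mult_L2[OF square_integrable_ft[OF integrable_trunc[OF f] square_integrable_trunc[OF f]]
            g square_integrable_translate_gauss lim])
    moreover have "(\<integral>\<omega>. ft (trunc r f) \<omega> * ?k \<omega> \<partial>lborel) = (\<integral>t. trunc r f t * ft ?k t \<partial>lborel)" for r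
      by (intro ft_multiplication_formula integrable_trunc f integrable_translate_gauss)
    moreover have "((\<lambda>r. \<integral>t. trunc r f t * ft ?k t \<partial>lborel) \<longlongrightarrow> (\<integral>t. f t * ft ?k t \<partial>lborel)) at_top"
      by (rule tendsto_integral_mult_L2[OF square_integrable_trunc[OF f] f
            square_integrable_ft[OF integrable_translate_gauss square_integrable_translate_gauss]
            sqnorm_diff_trunc_tendsto[OF f]])
    ultimately have "(\<integral>t. f t * ft ?k t \<partial>lborel) = (\<integral>\<omega>. g \<omega> * ?k \<omega> \<partial>lborel)"
      using tendsto_unique[OF trivial_limit_at_top_linorder] by simp
    also have "\<dots> = (\<integral>t. F t * ft ?k t \<partial>lborel)"
      unfolding F_def by (rule integral_inverse_ft_mult_ft[OF gi translate_gauss_inversion, symmetric])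
    finally have "(\<integral>t. complex_of_real (sqrt (2 * pi)) * (f t * wave (- y) t) \<partial>lborel)
        = (\<integral>t. complex_of_real (sqrt (2 * pi)) * (F t * wave (- y) t) \<partial>lborel)"
      by (simp only: ft_translate_gauss mult.left_commute)
    then show ?thesis by simp
  qed
  have "AE t in lborel. (f t - F t) * gauss 1 t = 0"
  proof (rule ft_eq_0_imp_AE_0)
    show "integrable lborel (\<lambda>t. (f t - F t) * gauss 1 t)"
      by (intro square_integrable_imp_integrable_mult square_integrable_diff f F square_integrable_gauss) simp
    fix y
    have "ft (\<lambda>t. (f t - F t) * gauss 1 t) y = (\<integral>t. f t * wave (- y) t - F t * wave (- y) t \<partial>lborel)"
      unfolding ft_def wave_def
      by (intro Bochner_Integration.integral_cong refl) (simp add: algebra_simps)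
    also have "\<dots> = 0"
      by (subst Bochner_Integration.integral_diff)
         (auto intro!: square_integrable_imp_integrable_mult f F square_integrable_wave simp: eq)
    finally show "ft (\<lambda>t. (f t - F t) * gauss 1 t) y = 0" .
  qed
  then have "AE t in lborel. f t = F t"
    by eventually_elim (simp add: gauss_def)
  moreover have "continuous_on UNIV F"
    unfolding F_def[abs_def]
    by (intro continuous_intros continuous_on_compose2[OF continuous_ft[OF gi]]) auto
  ultimately show ?thesis
    using continuous_AE_eq_imp_eq[OF cont] unfolding F_def by blast
qed

section \<open>Legendre polynomials\<close>

text \<open>As a linear functional on polynomials it lets integration by parts be carried out
  algebraically with \<open>pderiv\<close>.\<close>

definition poly_integral :: "real poly \<Rightarrow> real" where
  "poly_integral p = (\<integral>x. indicator {-1..1} x * poly p x \<partial>lborel)"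

lemma integrable_indicator_poly: "integrable lborel (\<lambda>x. indicator {a..b} x * poly p x)" for p :: "real poly"
  using borel_integrable_atLeastAtMost'[of a b "poly p"]
  by (simp add: set_integrable_def continuous_on_poly)

lemma poly_integral_add: "poly_integral (p + q) = poly_integral p + poly_integral q"
  unfolding poly_integral_def by (simp add: distrib_left integrable_indicator_poly)

lemma poly_integral_smult: "poly_integral (smult c p) = c * poly_integral p"
  unfolding poly_integral_def
  by (simp only: poly_smult mult.left_commute[of _ c] integral_mult_right_zero)

lemma poly_integral_pderiv: "poly_integral (pderiv p) = poly p 1 - poly p (-1)"
proof -
  have "(\<integral>x. indicator {-1..1} x *\<^sub>R poly (pderiv p) x \<partial>lborel) = poly p 1 - poly p (-1)"
  proof (rule integral_FTC_atLeastAtMost)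
    show "(poly p has_vector_derivative poly (pderiv p) x) (at x within {-1..1})" for x
      using poly_DERIV[of p x]
      by (simp add: has_real_derivative_iff_has_vector_derivative has_vector_derivative_at_within)
  qed (auto intro!: continuous_on_poly)
  then show ?thesis by (simp add: poly_integral_def)
qed

lemma poly_integral_by_parts:
  assumes "poly (p * q) 1 = poly (p * q) (-1)"
  shows "poly_integral (pderiv p * q) = - poly_integral (p * pderiv q)"
proof -
  have "poly_integral (pderiv (p * q)) = 0"
    using assms by (simp only: poly_integral_pderiv)
  then show ?thesis
    by (simp add: pderiv_mult poly_integral_add mult.commute)
qed

section \<open>Rodrigues' formula: orthogonality and norms\<close>

abbreviation sqm1 :: "real poly" where "sqm1 \<equiv> [:-1, 0, 1:]"

text \<open>A derivative lowers the multiplicity of the factor w by at most one. For w = x^2 - 1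
  this kills the boundary terms at 1 and -1 as long as fewer than n derivatives are taken.\<close>

lemma power_dvd_higher_pderiv:
  fixes w :: "real poly"
  shows "k \<le> n \<Longrightarrow> w ^ (n - k) dvd (pderiv ^^ k) (w ^ n)"
proof (induction k)
  case (Suc k)
  then obtain r where r: "(pderiv ^^ k) (w ^ n) = w ^ (Suc (n - Suc k)) * r"
    by (auto simp: Suc_diff_Suc elim!: dvdE)
  have "(pderiv ^^ Suc k) (w ^ n) = w ^ (n - Suc k) * (w * pderiv r + smult (of_nat (Suc (n - Suc k))) (pderiv w) * r)"
    unfolding funpow.simps comp_def r pderiv_mult pderiv_power_Suc by (simp add: algebra_simps)
  then show ?case by simp
qed simp

lemma poly_higher_pderiv_sqm1_eq_0:
  assumes "k < n" "x = 1 \<or> x = -1"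
  shows "poly ((pderiv ^^ k) (sqm1 ^ n)) x = 0"
proof -
  obtain r where "(pderiv ^^ k) (sqm1 ^ n) = sqm1 ^ (n - k) * r"
    using power_dvd_higher_pderiv[of k n sqm1] assms by (auto elim: dvdE)
  with assms show ?thesis by (auto simp: poly_power)
qed

text \<open>Each integration by parts moves one derivative from (x^2 - 1)^n to q. The case k = n
  yields orthogonality to lower degrees as well as the norm.\<close>

lemma poly_integral_Rodrigues:
  "k \<le> n \<Longrightarrow> poly_integral ((pderiv ^^ n) (sqm1 ^ n) * q)
     = (-1) ^ k * poly_integral ((pderiv ^^ (n - k)) (sqm1 ^ n) * (pderiv ^^ k) q)"
proof (induction k)
  case (Suc k)
  have e: "(pderiv ^^ (n - k)) (sqm1 ^ n) = pderiv ((pderiv ^^ (n - Suc k)) (sqm1 ^ n))"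
    using Suc.prems by (metis Suc_diff_Suc Suc_le_lessD comp_apply funpow.simps(2))
  have "poly_integral ((pderiv ^^ (n - k)) (sqm1 ^ n) * (pderiv ^^ k) q)
      = - poly_integral ((pderiv ^^ (n - Suc k)) (sqm1 ^ n) * (pderiv ^^ Suc k) q)"
    unfolding e funpow.simps comp_def
    by (rule poly_integral_by_parts)
       (use Suc.prems in \<open>simp add: poly_higher_pderiv_sqm1_eq_0\<close>)
  with Suc show ?case by simp
qed simp

lemma degree_sqm1_power: "degree (sqm1 ^ n) = 2 * n"
  by (simp add: degree_power_eq)

lemma coeff_sqm1_power: "coeff (sqm1 ^ n) (2 * n) = 1"
proof -
  have "lead_coeff (sqm1 ^ n) = 1" by (simp add: lead_coeff_power)
  then show ?thesis by (simp only: degree_sqm1_power)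
qed

lemma degree_Legendre_poly: "degree (Legendre_poly n) = n"
  by (simp add: Legendre_poly_def degree_higher_pderiv degree_sqm1_power)

lemma higher_pderiv_eq_0: "degree q < n \<Longrightarrow> (pderiv ^^ n) q = 0" for q :: "real poly"
  by (rule poly_eqI) (simp add: coeff_higher_pderiv coeff_eq_0)

lemma poly_integral_Legendre_orthogonal:
  assumes "degree q < n" shows "poly_integral (Legendre_poly n * q) = 0"
  using poly_integral_Rodrigues[of n n q] assms
  by (simp add: Legendre_poly_def poly_integral_smult higher_pderiv_eq_0 poly_integral_def)

text \<open>Integrate by parts with 1 as the derivative of x. For w = x^2 - 1 one has x w' = 2 x^2 =
  2 (w + 1), which reproduces the integrals of w^(n+1) and w^n.\<close>

lemma poly_integral_sqm1_power_Suc: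
  "(2 * real n + 3) * poly_integral (sqm1 ^ Suc n) = - (2 * (real n + 1)) * poly_integral (sqm1 ^ n)"
proof -
  have "poly_integral (sqm1 ^ Suc n) = poly_integral (pderiv [:0, 1:] * sqm1 ^ Suc n)"
    by (simp add: pderiv_pCons)
  also have "\<dots> = - poly_integral ([:0, 1:] * pderiv (sqm1 ^ Suc n))"
    by (rule poly_integral_by_parts) (simp add: poly_power)
  also have "[:0, 1:] * pderiv (sqm1 ^ Suc n) = smult (2 * (real n + 1)) (sqm1 ^ Suc n + sqm1 ^ n)"
    unfolding pderiv_power_Suc by (rule poly_ext) (simp add: pderiv_pCons algebra_simps)
  finally have "poly_integral (sqm1 ^ Suc n)
      = - (2 * (real n + 1)) * (poly_integral (sqm1 ^ Suc n) + poly_integral (sqm1 ^ n))"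
    by (simp only: poly_integral_smult poly_integral_add mult_minus_left)
  then show ?thesis by (simp add: algebra_simps)
qed

text \<open>A beta integral in factorial form, obtained by solving the preceding recursion.\<close>

lemma poly_integral_sqm1_power:
  "poly_integral (sqm1 ^ n) = (-1) ^ n * 2 ^ (2 * n + 1) * (fact n)\<^sup>2 / fact (2 * n + 1)"
proof (induction n)
  case 0
  show ?case using poly_integral_pderiv[of "[:0, 1:]"] by (simp add: pderiv_pCons one_pCons)
next
  case (Suc n)
  have f: "fact (2 * Suc n + 1) = (2 * real n + 3) * (2 * (real n + 1)) * fact (2 * n + 1)"
    by (simp add: algebra_simps)
  have "poly_integral (sqm1 ^ Suc n) = - (2 * (real n + 1)) * poly_integral (sqm1 ^ n) / (2 * real n + 3)"
    using poly_integral_sqm1_power_Suc[of n] by (simp add: field_simps del: power_Suc)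
  also have "\<dots> = (-1) ^ Suc n * 2 ^ (2 * Suc n + 1) * (fact (Suc n))\<^sup>2 / fact (2 * Suc n + 1)"
  proof -
    define A where "A = (-1) ^ n * 2 ^ (2 * n + 1) * (fact n :: real)\<^sup>2"
    define x where "x = real n + 1"
    define y where "y = 2 * real n + 3"
    define F where "F = (fact (2 * n + 1) :: real)"
    have nz: "x \<noteq> 0" "y \<noteq> 0" "F \<noteq> 0"
      by (auto simp: x_def y_def F_def)
    have "(-1) ^ Suc n * 2 ^ (2 * Suc n + 1) * (fact (Suc n) :: real)\<^sup>2 = - (4 * x\<^sup>2) * A"
      by (simp add: A_def x_def power_mult_distrib add.commute)
    moreover have "- (2 * x) * (A / F) / y = - (4 * x\<^sup>2) * A / (y * (2 * x) * F)"
      using nz by (simp add: field_simps power2_eq_square)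
    ultimately show ?thesis
      unfolding Suc f A_def[symmetric] F_def[symmetric] x_def[symmetric] y_def[symmetric] by simp
  qed
  finally show ?case .
qed

lemma poly_integral_Legendre_square:
  "poly_integral (Legendre_poly n * Legendre_poly n) = 2 / (2 * real n + 1)"
proof -
  define D where "D = (pderiv ^^ n) (sqm1 ^ n)"
  \<comment> \<open>In total this differentiates the monic polynomial (x^2 - 1)^n of degree 2n
    exactly 2n times, so the constant (2n)! remains.\<close>
  have "(pderiv ^^ n) D = [:fact (2 * n):]"
  proof (rule poly_eqI)
    fix k
    show "coeff ((pderiv ^^ n) D) k = coeff [:fact (2 * n):] k"
    proof (cases k)
      case 0
      have "coeff ((pderiv ^^ (n + n)) (sqm1 ^ n)) 0 = fact (2 * n)"
        using coeff_sqm1_power[of n] by (simp add: coeff_higher_pderiv pochhammer_fact mult_2)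
      then show ?thesis using 0 by (simp add: D_def funpow_add)
    next
      case (Suc j)
      then show ?thesis
        by (simp add: D_def coeff_higher_pderiv coeff_eq_0 degree_sqm1_power)
    qed
  qed
  then have "poly_integral (D * D) = (-1) ^ n * poly_integral (smult (fact (2 * n)) (sqm1 ^ n))"
    using poly_integral_Rodrigues[of n n D] by (simp add: D_def)
  also have "\<dots> = fact (2 * n) * 2 ^ (2 * n + 1) * (fact n)\<^sup>2 / fact (2 * n + 1)"
    by (simp add: poly_integral_smult poly_integral_sqm1_power flip: power_mult_distrib)
  finally have raw: "poly_integral (D * D) = fact (2 * n) * 2 ^ (2 * n + 1) * (fact n)\<^sup>2 / fact (2 * n + 1)" .
  have DD: "poly_integral (D * D) = 2 * (2 ^ n)\<^sup>2 * (fact n)\<^sup>2 / (2 * real n + 1)"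
  proof -
    have f: "fact (2 * n + 1) = (2 * real n + 1) * fact (2 * n)" and p: "2 ^ (2 * n + 1) = 2 * ((2::real) ^ n)\<^sup>2"
      by (simp_all add: algebra_simps flip: power_mult)
    show ?thesis
      using raw unfolding f p by simp
  qed
  have "Legendre_poly n * Legendre_poly n = smult ((1 / (2 ^ n * fact n))\<^sup>2) (D * D)"
    by (simp add: Legendre_poly_def D_def power2_eq_square)
  then show ?thesis
    by (simp only: poly_integral_smult DD) (simp add: divide_simps power2_eq_square)
qed

lemma poly_integral_Legendre:
  "poly_integral (Legendre_poly m * Legendre_poly n) = (if m = n then 2 / (2 * real n + 1) else 0)"
proof (cases m n rule: linorder_cases)
  case less
  then show ?thesis
    using poly_integral_Legendre_orthogonal[of "Legendre_poly m" n] by (simp add: degree_Legendre_poly mult.commute)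
next
  case greater
  then show ?thesis
    using poly_integral_Legendre_orthogonal[of "Legendre_poly n" m] by (simp add: degree_Legendre_poly)
qed (simp add: poly_integral_Legendre_square)

lemma degree_normalized_Legendre: "degree (normalized_Legendre n) = n"
  by (simp add: normalized_Legendre_def degree_pcompose degree_Legendre_poly)

text \<open>The degree alone does not exclude the zero polynomial when n is 0; the nonzero norm
  does. These coefficients are the diagonals of the triangular systems below.\<close>

lemma lead_coeff_normalized_Legendre: "coeff (normalized_Legendre n) n \<noteq> 0"
proof -
  have "normalized_Legendre n \<noteq> 0"
  proof
    assume "normalized_Legendre n = 0"
    then have "Legendre_poly n = 0"
      using pcompose_eq_0[of "Legendre_poly n" "[:0, 1 / pi:]"] by (simp add: normalized_Legendre_def)
    with poly_integral_Legendre_square[of n] show False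
      by (simp add: poly_integral_def)
  qed
  then show ?thesis
    using leading_coeff_neq_0 degree_normalized_Legendre by metis
qed

lemma normalized_Legendre_orthonormal:
  "(\<integral>\<omega>. indicator {-pi..pi} \<omega> * (poly (normalized_Legendre m) \<omega> * poly (normalized_Legendre n) \<omega>) \<partial>lborel)
    = (if m = n then 2 * pi else 0)"
proof -
  let ?c = "sqrt (2 * real m + 1) * sqrt (2 * real n + 1)"
  have "(\<integral>\<omega>. indicator {-pi..pi} \<omega> * (poly (normalized_Legendre m) \<omega> * poly (normalized_Legendre n) \<omega>) \<partial>lborel)
      = \<bar>pi\<bar> *\<^sub>R (\<integral>x. indicator {-pi..pi} (0 + pi * x)
          * (poly (normalized_Legendre m) (0 + pi * x) * poly (normalized_Legendre n) (0 + pi * x)) \<partial>lborel)"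
    by (rule lborel_integral_real_affine) simp
  also have "(\<integral>x. indicator {-pi..pi} (0 + pi * x)
          * (poly (normalized_Legendre m) (0 + pi * x) * poly (normalized_Legendre n) (0 + pi * x)) \<partial>lborel)
      = (\<integral>x. ?c * (indicator {-1..1} x * poly (Legendre_poly m * Legendre_poly n) x) \<partial>lborel)"
  proof (intro Bochner_Integration.integral_cong refl)
    fix x :: real
    have "indicator {-pi..pi} (0 + pi * x) = (indicator {-1..1} x :: real)"
      using mult_le_cancel_left_pos[OF pi_gt_zero, of "-1" x] mult_le_cancel_left_pos[OF pi_gt_zero, of x 1]
      by (auto simp: indicator_def)
    then show "indicator {-pi..pi} (0 + pi * x)
          * (poly (normalized_Legendre m) (0 + pi * x) * poly (normalized_Legendre n) (0 + pi * x))
        = ?c * (indicator {-1..1} x * poly (Legendre_poly m * Legendre_poly n) x)"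
      by (simp add: normalized_Legendre_def poly_pcompose)
  qed
  also have "\<dots> = ?c * poly_integral (Legendre_poly m * Legendre_poly n)"
    unfolding poly_integral_def by (rule integral_mult_right_zero)
  finally show ?thesis
    by (simp add: poly_integral_Legendre) (auto simp: field_simps)
qed

section \<open>Legendre expansions\<close>

text \<open>The cutoff lets all integrals run over the whole line. The values are real but typed as
  complex, so pairing with \<open>leg n\<close> needs no conjugate.\<close>

definition leg :: "nat \<Rightarrow> real \<Rightarrow> complex" where
  "leg n \<omega> = indicator {-pi..pi} \<omega> * complex_of_real (poly (normalized_Legendre n) \<omega>)"

lemma leg_eq_of_real:
  "leg n \<omega> = complex_of_real (indicator {-pi..pi} \<omega> * poly (normalized_Legendre n) \<omega>)"
  by (simp add: leg_def split: split_indicator)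

lemma cnj_leg [simp]: "cnj (leg n \<omega>) = leg n \<omega>"
  by (simp add: leg_eq_of_real)

lemma poly_borel_measurable [measurable]: "poly (p :: real poly) \<in> borel_measurable borel"
  by (intro borel_measurable_continuous_onI continuous_on_poly continuous_on_id)

lemma leg_mult: "leg m \<omega> * leg n \<omega> = complex_of_real
    (indicator {-pi..pi} \<omega> * (poly (normalized_Legendre m) \<omega> * poly (normalized_Legendre n) \<omega>))"
  by (simp add: leg_eq_of_real split: split_indicator)

lemma integral_leg: "(\<integral>\<omega>. leg m \<omega> * leg n \<omega> \<partial>lborel) = (if m = n then complex_of_real (2 * pi) else 0)"
  unfolding leg_mult integral_complex_of_real normalized_Legendre_orthonormal by simp

lemma leg_measurable [measurable]: "leg n \<in> borel_measurable borel"
  unfolding leg_def[abs_def] by measurable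

lemma square_integrable_leg [intro]: "square_integrable (leg n)"
proof -
  have "(norm (leg n x))\<^sup>2 = indicator {-pi..pi} x * poly (normalized_Legendre n * normalized_Legendre n) x" for x
    by (simp add: leg_def norm_mult power2_eq_square split: split_indicator)
  then show ?thesis
    by (simp add: square_integrable_def integrable_indicator_poly del: poly_mult)
qed

text \<open>With an arbitrary index set, the difference of two partial sums is again a
  \<open>leg_sum\<close>.\<close>

definition leg_sum :: "(nat \<Rightarrow> complex) \<Rightarrow> nat set \<Rightarrow> real \<Rightarrow> complex" where
  "leg_sum b A \<omega> = (\<Sum>n\<in>A. b n * leg n \<omega>)"

lemma square_integrable_leg_sum [intro]: "square_integrable (leg_sum b A)"
  unfolding leg_sum_def[abs_def]
  by (intro square_integrable_sum square_integrable_cmult square_integrable_leg)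

lemma integral_mult_leg_sum:
  assumes "square_integrable u"
  shows "(\<integral>\<omega>. u \<omega> * leg_sum b A \<omega> \<partial>lborel) = (\<Sum>n\<in>A. b n * (\<integral>\<omega>. u \<omega> * leg n \<omega> \<partial>lborel))"
proof -
  have "(\<integral>\<omega>. u \<omega> * leg_sum b A \<omega> \<partial>lborel) = (\<integral>\<omega>. (\<Sum>n\<in>A. b n * (u \<omega> * leg n \<omega>)) \<partial>lborel)"
    by (simp add: leg_sum_def sum_distrib_left mult.left_commute)
  also have "\<dots> = (\<Sum>n\<in>A. \<integral>\<omega>. b n * (u \<omega> * leg n \<omega>) \<partial>lborel)"
    using assms by (intro Bochner_Integration.integral_sum integrable_mult_right
        square_integrable_imp_integrable_mult square_integrable_leg)
  finally show ?thesis by simp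
qed

lemma integral_leg_sum_leg:
  assumes "finite A" "n \<in> A"
  shows "(\<integral>\<omega>. leg_sum b A \<omega> * leg n \<omega> \<partial>lborel) = complex_of_real (2 * pi) * b n"
proof -
  have "(\<integral>\<omega>. leg_sum b A \<omega> * leg n \<omega> \<partial>lborel) = (\<Sum>m\<in>A. b m * (\<integral>\<omega>. leg n \<omega> * leg m \<omega> \<partial>lborel))"
    by (subst mult.commute) (rule integral_mult_leg_sum[OF square_integrable_leg])
  also have "\<dots> = (\<Sum>m\<in>A. if n = m then complex_of_real (2 * pi) * b m else 0)"
    by (intro sum.cong refl) (simp only: integral_leg, simp)
  finally show ?thesis using assms by simp
qed

lemma cnj_leg_sum: "cnj (leg_sum b A \<omega>) = leg_sum (\<lambda>n. cnj (b n)) A \<omega>"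
  by (simp add: leg_sum_def)

lemma integral_norm_square:
  "complex_of_real (\<integral>x. (norm (u x))\<^sup>2 \<partial>lborel) = (\<integral>x. u x * cnj (u x) \<partial>lborel)" for u :: "real \<Rightarrow> complex"
  by (simp only: complex_norm_square flip: integral_complex_of_real)

lemma of_real_mult_norm_square: "complex_of_real (c * (norm z)\<^sup>2) = complex_of_real c * (z * cnj z)"
  by (simp only: of_real_mult complex_norm_square)

lemma sqnorm_leg_sum:
  assumes "finite A"
  shows "sqnorm (leg_sum b A) = ennreal (2 * pi * (\<Sum>n\<in>A. (norm (b n))\<^sup>2))"
proof -
  have "complex_of_real (\<integral>x. (norm (leg_sum b A x))\<^sup>2 \<partial>lborel)
      = (\<Sum>n\<in>A. cnj (b n) * (\<integral>\<omega>. leg_sum b A \<omega> * leg n \<omega> \<partial>lborel))"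
    unfolding integral_norm_square cnj_leg_sum by (rule integral_mult_leg_sum) auto
  also have "\<dots> = (\<Sum>n\<in>A. complex_of_real (2 * pi * (norm (b n))\<^sup>2))"
  proof (intro sum.cong refl)
    fix n assume "n \<in> A"
    then show "cnj (b n) * (\<integral>\<omega>. leg_sum b A \<omega> * leg n \<omega> \<partial>lborel) = complex_of_real (2 * pi * (norm (b n))\<^sup>2)"
      unfolding of_real_mult_norm_square integral_leg_sum_leg[OF assms \<open>n \<in> A\<close>] by (simp only: mult_ac)
  qed
  also have "\<dots> = complex_of_real (2 * pi * (\<Sum>n\<in>A. (norm (b n))\<^sup>2))"
    by (simp only: sum_distrib_left of_real_sum)
  finally have "(\<integral>x. (norm (leg_sum b A x))\<^sup>2 \<partial>lborel) = 2 * pi * (\<Sum>n\<in>A. (norm (b n))\<^sup>2)"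
    by (simp only: of_real_eq_iff)
  then show ?thesis
    using square_integrableD(3)[OF square_integrable_leg_sum] by simp
qed

lemma leg_outside: "\<omega> \<notin> {-pi..pi} \<Longrightarrow> leg n \<omega> = 0"
  by (simp add: leg_def)

text \<open>By Pythagoras the partial sums are Cauchy in L2, and their coefficients, eventually
  constant in N, pass to the limit.\<close>

lemma Legendre_Riesz_Fischer:
  assumes b: "summable (\<lambda>n. (norm (b n))\<^sup>2)"
  obtains v where "square_integrable v" "\<And>\<omega>. \<omega> \<notin> {-pi..pi} \<Longrightarrow> v \<omega> = 0"
    "(\<lambda>N. sqnorm (\<lambda>\<omega>. leg_sum b {..<N} \<omega> - v \<omega>)) \<longlonglongrightarrow> 0"
    "\<And>n. (\<integral>\<omega>. v \<omega> * leg n \<omega> \<partial>lborel) = complex_of_real (2 * pi) * b n"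
proof -
  have diff: "sqnorm (\<lambda>\<omega>. leg_sum b {..<m} \<omega> - leg_sum b {..<n} \<omega>)
      = ennreal (2 * pi * (\<Sum>k=n..<m. (norm (b k))\<^sup>2))" if "n \<le> m" for m n
  proof -
    have "{..<m} = {..<n} \<union> {n..<m}" using that by auto
    then have "leg_sum b {..<m} \<omega> - leg_sum b {..<n} \<omega> = leg_sum b {n..<m} \<omega>" for \<omega>
      unfolding leg_sum_def by (simp add: sum.union_disjoint ivl_disj_int)
    then show ?thesis by (simp add: sqnorm_leg_sum)
  qed
  obtain w where w: "square_integrable w"
    and lim: "(\<lambda>N. sqnorm (\<lambda>\<omega>. leg_sum b {..<N} \<omega> - w \<omega>)) \<longlonglongrightarrow> 0"
  proof (rule L2_complete[of "\<lambda>N. leg_sum b {..<N}"])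
    fix e :: real assume "0 < e"
    then have "0 < e / (2 * pi)" by simp
    with b obtain N where N: "\<And>m n. N \<le> m \<Longrightarrow> norm (\<Sum>k=m..<n. (norm (b k))\<^sup>2) < e / (2 * pi)"
      unfolding summable_Cauchy by blast
    have ge: "sqnorm (\<lambda>\<omega>. leg_sum b {..<m} \<omega> - leg_sum b {..<n} \<omega>) \<le> ennreal e" if "N \<le> n" "n \<le> m" for m n
    proof -
      have "2 * pi * (\<Sum>k=n..<m. (norm (b k))\<^sup>2) \<le> e"
        using N[OF that(1), of m] by (simp add: field_simps sum_nonneg)
      then show ?thesis unfolding diff[OF that(2)] by (rule ennreal_leI)
    qed
    have "\<forall>m\<ge>N. \<forall>n\<ge>N. sqnorm (\<lambda>\<omega>. leg_sum b {..<m} \<omega> - leg_sum b {..<n} \<omega>) \<le> ennreal e"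
    proof (intro allI impI)
      fix m n assume "N \<le> m" "N \<le> n"
      then show "sqnorm (\<lambda>\<omega>. leg_sum b {..<m} \<omega> - leg_sum b {..<n} \<omega>) \<le> ennreal e"
        using ge[of n m] ge[of m n] sqnorm_minus_commute[of "leg_sum b {..<m}" "leg_sum b {..<n}"]
        by (cases "n \<le> m") auto
    qed
    then show "\<exists>N. \<forall>m\<ge>N. \<forall>n\<ge>N. sqnorm (\<lambda>\<omega>. leg_sum b {..<m} \<omega> - leg_sum b {..<n} \<omega>) \<le> ennreal e" ..
  qed auto
  \<comment> \<open>The limit w is controlled only up to null sets. Truncation makes it vanish
    exactly outside [-\<pi>, \<pi>] and cannot increase the distance to the partial sums, which
    vanish there.\<close>
  define v where "v = trunc pi w"
  have v: "square_integrable v"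
    unfolding v_def by (rule square_integrable_trunc[OF w])
  have v0: "v \<omega> = 0" if "\<omega> \<notin> {-pi..pi}" for \<omega>
    using that by (simp add: v_def trunc_def)
  have "sqnorm (\<lambda>\<omega>. leg_sum b {..<N} \<omega> - v \<omega>) \<le> sqnorm (\<lambda>\<omega>. leg_sum b {..<N} \<omega> - w \<omega>)" for N
    by (intro sqnorm_mono AE_I2)
       (auto simp: v_def trunc_def leg_sum_def leg_outside split: split_indicator)
  then have limv: "(\<lambda>N. sqnorm (\<lambda>\<omega>. leg_sum b {..<N} \<omega> - v \<omega>)) \<longlonglongrightarrow> 0"
    by (rule tendsto_ennreal_0_sandwich[OF lim])
  have "(\<integral>\<omega>. v \<omega> * leg n \<omega> \<partial>lborel) = complex_of_real (2 * pi) * b n" for n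
  proof (rule LIMSEQ_unique)
    show "(\<lambda>N. \<integral>\<omega>. leg_sum b {..<N} \<omega> * leg n \<omega> \<partial>lborel) \<longlonglongrightarrow> (\<integral>\<omega>. v \<omega> * leg n \<omega> \<partial>lborel)"
      by (rule tendsto_integral_mult_L2[OF square_integrable_leg_sum v square_integrable_leg limv])
    have "\<forall>\<^sub>F N in sequentially. (\<integral>\<omega>. leg_sum b {..<N} \<omega> * leg n \<omega> \<partial>lborel) = complex_of_real (2 * pi) * b n"
      using eventually_gt_at_top[of n] by eventually_elim (rule integral_leg_sum_leg, auto)
    then show "(\<lambda>N. \<integral>\<omega>. leg_sum b {..<N} \<omega> * leg n \<omega> \<partial>lborel) \<longlonglongrightarrow> complex_of_real (2 * pi) * b n"
      by (rule tendsto_eventually)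
  qed
  with v v0 limv show ?thesis by (rule that)
qed

section \<open>Moments, completeness and Parseval's identity\<close>

lemma bounded_support_moment:
  assumes u: "integrable lborel u" and 0: "AE t in lborel. t \<notin> {-B..B} \<longrightarrow> u t = 0"
  shows "AE t in lborel. norm (u t * complex_of_real t ^ k) \<le> norm (u t) * \<bar>B\<bar> ^ k"
    and "integrable lborel (\<lambda>t. u t * complex_of_real t ^ k)"
proof -
  have [measurable]: "u \<in> borel_measurable borel" using u by auto
  show le: "AE t in lborel. norm (u t * complex_of_real t ^ k) \<le> norm (u t) * \<bar>B\<bar> ^ k"
    using 0
  proof eventually_elim
    case (elim t)
    then show ?case
      by (cases "t \<in> {-B..B}") (auto simp: norm_mult norm_power intro!: mult_left_mono power_mono)
  qed
  show "integrable lborel (\<lambda>t. u t * complex_of_real t ^ k)"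
  proof (rule Bochner_Integration.integrable_bound)
    show "integrable lborel (\<lambda>t. norm (u t) * \<bar>B\<bar> ^ k)" using u by simp
  qed (use le in auto)
qed

text \<open>Bounded support dominates the k-th term of the exponential series by the L1 norm of u
  times (|c| |B|)^k / k!, so it may be integrated termwise. The moments of u thus determine its
  transform.\<close>

lemma integral_exp_sums:
  assumes u: "integrable lborel u" and 0: "AE t in lborel. t \<notin> {-B..B} \<longrightarrow> u t = 0"
  shows "(\<lambda>k. c ^ k / fact k * (\<integral>t. u t * complex_of_real t ^ k \<partial>lborel))
    sums (\<integral>t. u t * exp (c * complex_of_real t) \<partial>lborel)"
proof -
  have [measurable]: "u \<in> borel_measurable borel" using u by auto
  let ?f = "\<lambda>k t. c ^ k / fact k * (u t * complex_of_real t ^ k)"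
  have i: "integrable lborel (?f k)" for k
    by (intro integrable_mult_right bounded_support_moment(2)[OF u 0])
  have s: "(\<lambda>k. ?f k t) sums (u t * exp (c * complex_of_real t))" for t
    using sums_mult[OF exp_converges[of "c * complex_of_real t"], of "u t"]
    by (simp add: power_mult_distrib scaleR_conv_of_real divide_inverse mult_ac)
  have "(\<lambda>k. integral\<^sup>L lborel (?f k)) sums (\<integral>t. (\<Sum>k. ?f k t) \<partial>lborel)"
  proof (rule sums_integral[OF i])
    have "norm (?f k t) = norm (u t) * norm ((c * complex_of_real t) ^ k /\<^sub>R fact k)" for k t
      by (simp add: norm_mult norm_divide norm_power power_mult_distrib divide_inverse norm_inverse mult_ac)
    moreover have "summable (\<lambda>k. norm (u t) * norm ((c * complex_of_real t) ^ k /\<^sub>R fact k))" for t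
      by (intro summable_mult summable_norm_exp)
    ultimately show "AE t in lborel. summable (\<lambda>k. norm (?f k t))"
      by (simp only: AE_I2)
    show "summable (\<lambda>k. \<integral>t. norm (?f k t) \<partial>lborel)"
    proof (rule summable_comparison_test')
      show "summable (\<lambda>k. (\<integral>t. norm (u t) \<partial>lborel) * ((norm c * \<bar>B\<bar>) ^ k /\<^sub>R fact k))"
        by (intro summable_mult summable_exp_generic)
      fix k :: nat
      have "norm (\<integral>t. norm (?f k t) \<partial>lborel) = (\<integral>t. norm (?f k t) \<partial>lborel)" by simp
      also have "\<dots> \<le> (\<integral>t. norm c ^ k / fact k * (norm (u t) * \<bar>B\<bar> ^ k) \<partial>lborel)"
      proof (rule integral_mono_AE)
        show "AE t in lborel. norm (?f k t) \<le> norm c ^ k / fact k * (norm (u t) * \<bar>B\<bar> ^ k)"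
          using bounded_support_moment(1)[OF u 0, of k]
          by eventually_elim (simp only: norm_mult[of "c ^ k / fact k"] norm_divide norm_power norm_fact,
             rule mult_left_mono, auto)
      qed (use i u in auto)
      also have "\<dots> = (\<integral>t. norm (u t) \<partial>lborel) * ((norm c * \<bar>B\<bar>) ^ k /\<^sub>R fact k)"
        by (simp add: power_mult_distrib divide_inverse mult_ac)
      finally show "norm (\<integral>t. norm (?f k t) \<partial>lborel) \<le> (\<integral>t. norm (u t) \<partial>lborel) * ((norm c * \<bar>B\<bar>) ^ k /\<^sub>R fact k)" .
    qed
  qed
  then show ?thesis
    by (simp only: sums_unique[OF s, symmetric] integral_mult_right_zero)
qed

text \<open>Forward substitution. It serves twice: to pass from Legendre coefficients to moments,
  and from chromatic to ordinary derivatives.\<close>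

lemma triangular_zero:
  fixes c :: "nat \<Rightarrow> nat \<Rightarrow> complex"
  assumes "\<And>n. c n n \<noteq> 0" "\<And>n. (\<Sum>k\<le>n. c n k * a k) = 0"
  shows "a n = 0"
proof (induction n rule: less_induct)
  case (less n)
  have "(\<Sum>k\<le>n. c n k * a k) = (\<Sum>k<n. c n k * a k) + c n n * a n"
    by (simp add: lessThan_Suc_atMost[symmetric])
  also have "(\<Sum>k<n. c n k * a k) = 0"
    using less by (intro sum.neutral) auto
  finally show ?case using assms(1)[of n] assms(2)[of n] by simp
qed

lemma integral_mult_leg_moments:
  assumes u: "integrable lborel u" and 0: "AE t in lborel. t \<notin> {-pi..pi} \<longrightarrow> u t = 0"
  shows "(\<integral>\<omega>. u \<omega> * leg n \<omega> \<partial>lborel)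
    = (\<Sum>k\<le>n. complex_of_real (coeff (normalized_Legendre n) k) * (\<integral>\<omega>. u \<omega> * complex_of_real \<omega> ^ k \<partial>lborel))"
proof -
  have [measurable]: "u \<in> borel_measurable borel" using u by auto
  have "(\<integral>\<omega>. u \<omega> * leg n \<omega> \<partial>lborel)
      = (\<integral>\<omega>. (\<Sum>k\<le>n. complex_of_real (coeff (normalized_Legendre n) k) * (u \<omega> * complex_of_real \<omega> ^ k)) \<partial>lborel)"
  proof (rule Bochner_Integration.integral_cong_AE)
    show "AE \<omega> in lborel. u \<omega> * leg n \<omega>
        = (\<Sum>k\<le>n. complex_of_real (coeff (normalized_Legendre n) k) * (u \<omega> * complex_of_real \<omega> ^ k))"
      using 0
    proof eventually_elim
      case (elim \<omega>)
      then show ?case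
        by (cases "\<omega> \<in> {-pi..pi}")
           (auto simp: leg_def poly_altdef degree_normalized_Legendre sum_distrib_left mult_ac)
    qed
  qed measurable
  also have "\<dots> = (\<Sum>k\<le>n. \<integral>\<omega>. complex_of_real (coeff (normalized_Legendre n) k) * (u \<omega> * complex_of_real \<omega> ^ k) \<partial>lborel)"
    by (intro Bochner_Integration.integral_sum integrable_mult_right bounded_support_moment(2)[OF u 0])
  finally show ?thesis by simp
qed

text \<open>Orthogonality to every \<open>leg n\<close> annihilates all moments, by triangularity;
  then the exponential series of \<open>ft u\<close> vanishes term by term and injectivity
  applies.\<close>

lemma Legendre_complete:
  assumes u: "square_integrable u" and 0: "AE t in lborel. t \<notin> {-pi..pi} \<longrightarrow> u t = 0"
    and orth: "\<And>n. (\<integral>\<omega>. u \<omega> * leg n \<omega> \<partial>lborel) = 0"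
  shows "AE \<omega> in lborel. u \<omega> = 0"
proof -
  have ui: "integrable lborel u"
    by (rule square_integrable_bounded_support_integrable[OF u 0])
  have mom: "(\<integral>\<omega>. u \<omega> * complex_of_real \<omega> ^ k \<partial>lborel) = 0" for k
  proof (rule triangular_zero[where c = "\<lambda>n k. complex_of_real (coeff (normalized_Legendre n) k)"])
    show "(\<Sum>k\<le>n. complex_of_real (coeff (normalized_Legendre n) k) * (\<integral>\<omega>. u \<omega> * complex_of_real \<omega> ^ k \<partial>lborel)) = 0" for n
      using orth[of n] integral_mult_leg_moments[OF ui 0, of n] by simp
  qed (simp add: lead_coeff_normalized_Legendre)
  have "ft u s = 0" for s
  proof -
    have "(\<lambda>k. 0) sums ft u s"
      using integral_exp_sums[OF ui 0, of "- \<i> * complex_of_real s"] by (simp add: mom ft_def)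
    then show ?thesis by (rule sums_unique2[OF _ sums_zero])
  qed
  then show ?thesis by (rule ft_eq_0_imp_AE_0[OF ui])
qed

text \<open>Bessel's inequality makes the coefficients square summable. Riesz-Fischer then builds a
  function with these coefficients, and completeness identifies it with u; hence the partial sums
  converge to u and the Bessel defect tends to 0.\<close>

lemma Legendre_Parseval:
  assumes u: "square_integrable u" and 0: "AE t in lborel. t \<notin> {-pi..pi} \<longrightarrow> u t = 0"
  shows "(\<lambda>n. (norm (\<integral>\<omega>. u \<omega> * leg n \<omega> \<partial>lborel))\<^sup>2) sums (2 * pi * (\<integral>\<omega>. (norm (u \<omega>))\<^sup>2 \<partial>lborel))"
proof -
  \<comment> \<open>Division by 2\<pi>, the squared norm of \<open>leg n\<close>, turns the inner
    products into expansion coefficients.\<close>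
  define b where "b n = (\<integral>\<omega>. u \<omega> * leg n \<omega> \<partial>lborel) / complex_of_real (2 * pi)" for n
  have c: "(\<integral>\<omega>. u \<omega> * leg n \<omega> \<partial>lborel) = complex_of_real (2 * pi) * b n" for n
    by (simp add: b_def)
  define U where "U = (\<integral>\<omega>. (norm (u \<omega>))\<^sup>2 \<partial>lborel)"
  have pyth: "(\<integral>\<omega>. (norm (u \<omega> - leg_sum b {..<N} \<omega>))\<^sup>2 \<partial>lborel) = U - 2 * pi * (\<Sum>n<N. (norm (b n))\<^sup>2)" for N
  proof -
    \<comment> \<open>Since each \<open>leg n\<close> is real, conjugating a partial sum only
      conjugates its coefficients.\<close>
    let ?s = "leg_sum b {..<N}" let ?s' = "leg_sum (\<lambda>n. cnj (b n)) {..<N}"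
    note [simp] = square_integrable_imp_integrable_mult
    have us: "(\<integral>\<omega>. u \<omega> * ?s' \<omega> \<partial>lborel) = complex_of_real (2 * pi * (\<Sum>n<N. (norm (b n))\<^sup>2))"
      unfolding integral_mult_leg_sum[OF u] c sum_distrib_left of_real_sum
      unfolding of_real_mult_norm_square by (intro sum.cong refl) (simp only: mult_ac)
    have ss: "(\<integral>\<omega>. ?s \<omega> * ?s' \<omega> \<partial>lborel) = complex_of_real (2 * pi * (\<Sum>n<N. (norm (b n))\<^sup>2))"
      unfolding integral_mult_leg_sum[OF square_integrable_leg_sum] sum_distrib_left of_real_sum
      unfolding of_real_mult_norm_square
      by (intro sum.cong refl) (simp only: integral_leg_sum_leg finite_lessThan, simp only: mult_ac)
    have su: "(\<integral>\<omega>. ?s \<omega> * cnj (u \<omega>) \<partial>lborel) = cnj (\<integral>\<omega>. u \<omega> * ?s' \<omega> \<partial>lborel)"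
    proof -
      have "?s \<omega> * cnj (u \<omega>) = cnj (u \<omega> * ?s' \<omega>)" for \<omega>
        by (simp add: cnj_leg_sum)
      then show ?thesis by (simp only: Bochner_Integration.integral_cnj)
    qed
    have "complex_of_real (\<integral>\<omega>. (norm (u \<omega> - ?s \<omega>))\<^sup>2 \<partial>lborel)
        = (\<integral>\<omega>. (u \<omega> * cnj (u \<omega>) - u \<omega> * ?s' \<omega>) - (?s \<omega> * cnj (u \<omega>) - ?s \<omega> * ?s' \<omega>) \<partial>lborel)"
      unfolding integral_norm_square by (simp add: cnj_leg_sum algebra_simps)
    also have "\<dots> = ((\<integral>\<omega>. u \<omega> * cnj (u \<omega>) \<partial>lborel) - (\<integral>\<omega>. u \<omega> * ?s' \<omega> \<partial>lborel))
        - ((\<integral>\<omega>. ?s \<omega> * cnj (u \<omega>) \<partial>lborel) - (\<integral>\<omega>. ?s \<omega> * ?s' \<omega> \<partial>lborel))"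
      using u by (simp add: square_integrable_cnj square_integrable_leg_sum)
    also have "\<dots> = complex_of_real (U - 2 * pi * (\<Sum>n<N. (norm (b n))\<^sup>2))"
      unfolding su us ss integral_norm_square[symmetric] U_def by simp
    finally show ?thesis by (simp only: of_real_eq_iff)
  qed
  have "summable (\<lambda>n. (norm (b n))\<^sup>2)"
  proof (rule summableI_nonneg_bounded)
    fix N
    have "0 \<le> (\<integral>\<omega>. (norm (u \<omega> - leg_sum b {..<N} \<omega>))\<^sup>2 \<partial>lborel)" by simp
    then show "(\<Sum>n<N. (norm (b n))\<^sup>2) \<le> U / (2 * pi)"
      unfolding pyth by (simp add: field_simps)
  qed simp
  then obtain v where v: "square_integrable v" "\<And>\<omega>. \<omega> \<notin> {-pi..pi} \<Longrightarrow> v \<omega> = 0"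
    and lim: "(\<lambda>N. sqnorm (\<lambda>\<omega>. leg_sum b {..<N} \<omega> - v \<omega>)) \<longlonglongrightarrow> 0"
    and vc: "\<And>n. (\<integral>\<omega>. v \<omega> * leg n \<omega> \<partial>lborel) = complex_of_real (2 * pi) * b n"
    by (rule Legendre_Riesz_Fischer) blast
  have "AE \<omega> in lborel. u \<omega> - v \<omega> = 0"
  proof (rule Legendre_complete)
    show "AE t in lborel. t \<notin> {-pi..pi} \<longrightarrow> u t - v t = 0"
      using 0 by eventually_elim (simp add: v(2))
    show "(\<integral>\<omega>. (u \<omega> - v \<omega>) * leg n \<omega> \<partial>lborel) = 0" for n
      by (simp only: left_diff_distrib Bochner_Integration.integral_diff[OF
          square_integrable_imp_integrable_mult[OF u square_integrable_leg]
          square_integrable_imp_integrable_mult[OF v(1) square_integrable_leg]] c vc) simp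
  qed (use u v in auto)
  then have "sqnorm (\<lambda>\<omega>. leg_sum b {..<N} \<omega> - v \<omega>) = sqnorm (\<lambda>\<omega>. u \<omega> - leg_sum b {..<N} \<omega>)" for N
    unfolding sqnorm_minus_commute[of u] by (intro sqnorm_cong_AE) auto
  also have "\<dots> N = ennreal (U - 2 * pi * (\<Sum>n<N. (norm (b n))\<^sup>2))" for N
    by (subst square_integrableD(3)[OF square_integrable_diff[OF u square_integrable_leg_sum]]) (simp only: pyth)
  finally have "(\<lambda>N. ennreal (U - 2 * pi * (\<Sum>n<N. (norm (b n))\<^sup>2))) \<longlonglongrightarrow> 0"
    using lim by simp
  then have "(\<lambda>N. U - 2 * pi * (\<Sum>n<N. (norm (b n))\<^sup>2)) \<longlonglongrightarrow> 0"
    by (rule tendsto_ennreal_0D[rotated]) (simp flip: pyth)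
  then have "(\<lambda>N. 2 * pi * (U - (U - 2 * pi * (\<Sum>n<N. (norm (b n))\<^sup>2)))) \<longlonglongrightarrow> 2 * pi * (U - 0)"
    by (intro tendsto_intros)
  moreover have "2 * pi * (U - (U - 2 * pi * (\<Sum>n<N. (norm (b n))\<^sup>2)))
      = (\<Sum>n<N. (norm (\<integral>\<omega>. u \<omega> * leg n \<omega> \<partial>lborel))\<^sup>2)" for N
    unfolding c by (simp add: norm_mult power_mult_distrib power2_eq_square sum_distrib_left mult_ac)
  ultimately show ?thesis
    by (simp add: sums_def U_def)
qed

section \<open>Chromatic derivatives\<close>

text \<open>The induction varies the series: \<open>deriv f\<close> is again an everywhere
  convergent power series, with coefficients \<open>diffs a\<close>.\<close>

lemma higher_deriv_power_series_0:
  fixes f :: "real \<Rightarrow> real"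
  assumes "\<And>h. (\<lambda>k. a k * h ^ k) sums f h"
  shows "(deriv ^^ n) f 0 = fact n * a n"
  using assms
proof (induction n arbitrary: a f)
  case 0
  have "(\<lambda>k. a k * 0 ^ k) sums a 0"
    by (rule powser_sums_zero)
  then show ?case using sums_unique2[OF 0[of 0]] by simp
next
  case (Suc n)
  have f: "f = (\<lambda>h. \<Sum>k. a k * h ^ k)"
    using Suc.prems by (auto simp: sums_iff)
  have s: "summable (\<lambda>k. a k * h ^ k)" for h
    using Suc.prems by (auto simp: sums_iff)
  have d: "deriv f h = (\<Sum>k. diffs a k * h ^ k)" for h
    unfolding f by (intro DERIV_imp_deriv termdiffs_strong_converges_everywhere s)
  have "summable (\<lambda>k. diffs a k * h ^ k)" for h
    by (rule termdiff_converges_all[OF s])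
  then have "(\<lambda>k. diffs a k * h ^ k) sums deriv f h" for h
    unfolding d by (rule summable_sums)
  from Suc.IH[OF this] show ?case
    by (simp add: funpow_Suc_right diffs_def del: funpow.simps)
qed

lemma higher_deriv_power_series:
  fixes f :: "real \<Rightarrow> real"
  assumes "\<And>h. (\<lambda>k. a k * h ^ k) sums f (s + h)"
  shows "(deriv ^^ n) f s = fact n * a n"
  unfolding higher_deriv_shift_0[of n f s] using assms
  by (intro higher_deriv_power_series_0) (simp add: o_def)

text \<open>\<open>moment g s k\<close> is \<open>(-i)^k\<close> times the \<open>k\<close>-th derivative at \<open>s\<close> of the inverse
  transform of \<open>g\<close>.\<close>

definition moment :: "(real \<Rightarrow> complex) \<Rightarrow> real \<Rightarrow> nat \<Rightarrow> complex" where
  "moment g s k = (\<integral>\<omega>. g \<omega> * exp (\<i> * complex_of_real s * complex_of_real \<omega>) * complex_of_real \<omega> ^ k \<partial>lborel)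
    / complex_of_real (2 * pi)"

lemma integrable_modulate:
  assumes "integrable lborel g"
  shows "integrable lborel (\<lambda>\<omega>. g \<omega> * exp (\<i> * complex_of_real s * complex_of_real \<omega>))"
  using integrable_ft[OF assms, of "-s"] by simp

text \<open>Taylor expansion about s: the factor e^(i\<omega>s) is absorbed into g, which keeps its
  support, and only e^(i\<omega>h) is expanded.\<close>

lemma inverse_ft_sums:
  assumes g: "integrable lborel g" and 0: "AE \<omega> in lborel. \<omega> \<notin> {-B..B} \<longrightarrow> g \<omega> = 0"
  shows "(\<lambda>k. \<i> ^ k * moment g s k / fact k * complex_of_real h ^ k) sums (ft g (- (s + h)) / complex_of_real (2 * pi))"
proof -
  let ?u = "\<lambda>\<omega>. g \<omega> * exp (\<i> * complex_of_real s * complex_of_real \<omega>)"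
  have "(\<lambda>k. (\<i> * complex_of_real h) ^ k / fact k * (\<integral>\<omega>. ?u \<omega> * complex_of_real \<omega> ^ k \<partial>lborel))
      sums (\<integral>\<omega>. ?u \<omega> * exp (\<i> * complex_of_real h * complex_of_real \<omega>) \<partial>lborel)"
    by (rule integral_exp_sums[OF integrable_modulate[OF g], of B]) (use 0 in auto)
  then have "(\<lambda>k. (\<i> * complex_of_real h) ^ k / fact k * (\<integral>\<omega>. ?u \<omega> * complex_of_real \<omega> ^ k \<partial>lborel) / complex_of_real (2 * pi))
      sums ((\<integral>\<omega>. ?u \<omega> * exp (\<i> * complex_of_real h * complex_of_real \<omega>) \<partial>lborel) / complex_of_real (2 * pi))"
    by (rule sums_divide)
  moreover have "(\<integral>\<omega>. ?u \<omega> * exp (\<i> * complex_of_real h * complex_of_real \<omega>) \<partial>lborel) = ft g (- (s + h))"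
    unfolding ft_def
    by (intro Bochner_Integration.integral_cong refl)
       (simp add: mult.assoc algebra_simps flip: exp_add)
  moreover have "(\<i> * complex_of_real h) ^ k / fact k * (\<integral>\<omega>. ?u \<omega> * complex_of_real \<omega> ^ k \<partial>lborel) / complex_of_real (2 * pi)
      = \<i> ^ k * moment g s k / fact k * complex_of_real h ^ k" for k
    by (simp add: moment_def power_mult_distrib mult_ac)
  ultimately show ?thesis by simp
qed

lemma sums_Re_power:
  assumes "(\<lambda>k. c k * complex_of_real h ^ k) sums l"
  shows "(\<lambda>k. Re (c k) * h ^ k) sums Re l"
proof -
  have "(\<lambda>k. Re (c k * complex_of_real h ^ k)) sums Re l"
    using assms by (rule sums_Re)
  moreover have "Re (c k * complex_of_real h ^ k) = Re (c k) * h ^ k" for k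
    by (simp flip: of_real_power)
  ultimately show ?thesis by simp
qed

lemma sums_Im_power:
  assumes "(\<lambda>k. c k * complex_of_real h ^ k) sums l"
  shows "(\<lambda>k. Im (c k) * h ^ k) sums Im l"
proof -
  have "(\<lambda>k. Im (c k * complex_of_real h ^ k)) sums Im l"
    using assms by (rule sums_Im)
  moreover have "Im (c k * complex_of_real h ^ k) = Im (c k) * h ^ k" for k
    by (simp flip: of_real_power)
  ultimately show ?thesis by simp
qed

lemma higher_deriv_eq_moment:
  fixes f :: "real \<Rightarrow> real"
  assumes g: "integrable lborel g" and 0: "AE \<omega> in lborel. \<omega> \<notin> {-B..B} \<longrightarrow> g \<omega> = 0"
    and f: "\<And>t. complex_of_real (f t) = ft g (- t) / complex_of_real (2 * pi)"
  shows "complex_of_real ((deriv ^^ k) f s) = \<i> ^ k * moment g s k"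
proof -
  have sums: "(\<lambda>k. \<i> ^ k * moment g s k / fact k * complex_of_real h ^ k) sums complex_of_real (f (s + h))" for h
    unfolding f by (rule inverse_ft_sums[OF g 0])
  define z where "z = \<i> ^ k * moment g s k"
  have "(deriv ^^ k) f s = fact k * Re (z / fact k)"
    unfolding z_def using sums_Re_power[OF sums] by (intro higher_deriv_power_series) simp
  \<comment> \<open>Because f is real, the imaginary parts of the coefficients form a power series
    of the zero function.\<close>
  moreover have "(deriv ^^ k) (\<lambda>_. 0 :: real) s = fact k * Im (z / fact k)"
    unfolding z_def using sums_Im_power[OF sums] by (intro higher_deriv_power_series) simp
  moreover have "(deriv ^^ k) (\<lambda>_. 0 :: real) s = 0"
    using higher_deriv_power_series[of "\<lambda>_. 0" "\<lambda>_. 0" s k] by simp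
  moreover have "Re (z / fact k) = Re z / fact k" "Im (z / fact k) = Im z / fact k"
    using Re_divide_of_real[of z "fact k"] Im_divide_of_real[of z "fact k"] by simp_all
  ultimately have "Re z = (deriv ^^ k) f s" "Im z = 0" by simp_all
  then show ?thesis unfolding z_def[symmetric] by (intro complex_eqI) simp_all
qed

text \<open>By parity only coefficients with n + k even survive, and for these i^k i^k = (-1)^k =
  (-1)^n no longer depends on k. What remains is the polynomial itself applied to the
  moments.\<close>

lemma chromatic_deriv_complex_eq:
  assumes g: "integrable lborel g" and 0: "AE \<omega> in lborel. \<omega> \<notin> {-pi..pi} \<longrightarrow> g \<omega> = 0"
    and f: "\<And>k. complex_of_real ((deriv ^^ k) f s) = \<i> ^ k * moment g s k"
  shows "chromatic_deriv_complex n f s = \<i> ^ n *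
    (\<integral>\<omega>. g \<omega> * exp (\<i> * complex_of_real s * complex_of_real \<omega>) * leg n \<omega> \<partial>lborel) / complex_of_real (2 * pi)"
proof -
  let ?c = "\<lambda>k. complex_of_real (coeff (normalized_Legendre n) k)"
  have eq: "?c k * \<i> ^ k * complex_of_real ((deriv ^^ k) f s) = (-1) ^ n * (?c k * moment g s k)" for k
  proof (cases "even (n + k)")
    case True
    then have "(-1) ^ n = ((-1) ^ k :: complex)"
      by (auto simp: minus_one_power_iff)
    moreover have "\<i> ^ k * \<i> ^ k = (-1 :: complex) ^ k"
      by (simp flip: power_mult_distrib)
    ultimately show ?thesis unfolding f by (simp add: mult_ac)
  qed (simp add: coeff_normalized_Legendre_odd)
  have "chromatic_deriv_complex n f s = (- \<i>) ^ n * ((-1) ^ n * (\<Sum>k\<le>n. ?c k * moment g s k))"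
    by (simp only: chromatic_deriv_complex_def degree_normalized_Legendre eq flip: sum_distrib_left)
  also have "\<dots> = \<i> ^ n * (\<Sum>k\<le>n. ?c k * moment g s k)"
    by (simp add: mult.assoc[symmetric] flip: power_mult_distrib)
  also have "(\<Sum>k\<le>n. ?c k * moment g s k)
      = (\<integral>\<omega>. g \<omega> * exp (\<i> * complex_of_real s * complex_of_real \<omega>) * leg n \<omega> \<partial>lborel) / complex_of_real (2 * pi)"
    using 0 by (subst integral_mult_leg_moments[OF integrable_modulate[OF g]])
      (auto simp: moment_def sum_divide_distrib)
  finally show ?thesis by simp
qed

lemma chromatic_derivs_determine_higher_derivs:
  assumes "\<And>n. chromatic_deriv_complex n f s = \<i> ^ n *
    (\<Sum>k\<le>n. complex_of_real (coeff (normalized_Legendre n) k) * m k)"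
  shows "complex_of_real ((deriv ^^ k) f s) = \<i> ^ k * m k"
proof -
  \<comment> \<open>The claim multiplied by i^k, where i^k i^k = (-1)^k: in this form the defect
    solves the homogeneous triangular system of the Legendre coefficients.\<close>
  have "\<i> ^ k * complex_of_real ((deriv ^^ k) f s) - (-1) ^ k * m k = 0" for k
  proof (rule triangular_zero[where c = "\<lambda>n k. complex_of_real (coeff (normalized_Legendre n) k)"])
    fix n
    let ?c = "\<lambda>k. complex_of_real (coeff (normalized_Legendre n) k)"
    have eq: "?c k * ((-1) ^ k * m k) = (-1) ^ n * (?c k * m k)" for k
      by (cases "even (n + k)") (auto simp: minus_one_power_iff coeff_normalized_Legendre_odd)
    have "(\<Sum>k\<le>n. ?c k * ((-1) ^ k * m k)) = (-1) ^ n * (\<Sum>k\<le>n. ?c k * m k)"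
      by (simp only: eq flip: sum_distrib_left)
    moreover have "(\<Sum>k\<le>n. ?c k * (\<i> ^ k * complex_of_real ((deriv ^^ k) f s))) = (-1) ^ n * (\<Sum>k\<le>n. ?c k * m k)"
    proof -
      have "(- \<i>) ^ n * (\<Sum>k\<le>n. ?c k * (\<i> ^ k * complex_of_real ((deriv ^^ k) f s)))
          = \<i> ^ n * (\<Sum>k\<le>n. ?c k * m k)"
        using assms[of n] by (simp add: chromatic_deriv_complex_def degree_normalized_Legendre mult.assoc)
      also have "\<dots> = (- \<i>) ^ n * ((-1) ^ n * (\<Sum>k\<le>n. ?c k * m k))"
        by (simp add: mult.assoc[symmetric] flip: power_mult_distrib)
      finally show ?thesis by simp
    qed
    ultimately show "(\<Sum>k\<le>n. ?c k * (\<i> ^ k * complex_of_real ((deriv ^^ k) f s) - (-1) ^ k * m k)) = 0"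
      by (simp add: right_diff_distrib sum_subtractf)
  qed (simp add: lead_coeff_normalized_Legendre)
  then have "\<i> ^ k * complex_of_real ((deriv ^^ k) f s) = \<i> ^ k * (\<i> ^ k * m k)"
    by (simp add: mult.assoc[symmetric] flip: power_mult_distrib)
  then show ?thesis by simp
qed

text \<open>The real parts of the Taylor coefficients of F form a power series for f on the real
  line, and such a series forces the derivatives of f. The complex derivatives of F are never
  compared with those of f.\<close>

lemma entire_real_Taylor:
  fixes f :: "real \<Rightarrow> real"
  assumes F: "F holomorphic_on UNIV" "\<And>t. F (complex_of_real t) = complex_of_real (f t)"
  shows "(\<lambda>k. (deriv ^^ k) f 0 / fact k * t ^ k) sums f t"
proof -
  define b where "b k = (deriv ^^ k) F 0 / fact k" for k
  have s: "(\<lambda>k. Re (b k) * h ^ k) sums f h" for h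
  proof -
    have "(\<lambda>k. b k * (complex_of_real h - 0) ^ k) sums F (complex_of_real h)"
      unfolding b_def
      by (rule holomorphic_power_series[where r = "\<bar>h\<bar> + 1"]) (use F(1) in \<open>auto intro: holomorphic_on_subset\<close>)
    then show ?thesis using sums_Re_power[of b h "F (complex_of_real h)"] by (simp add: F(2))
  qed
  have "(deriv ^^ k) f 0 = fact k * Re (b k)" for k
    by (rule higher_deriv_power_series_0[OF s])
  with s[of t] show ?thesis by simp
qed

lemma BL_chromatic_sums:
  fixes f :: "real \<Rightarrow> real"
  assumes "(\<lambda>t. complex_of_real (f t)) \<in> BL pi"
  obtains c where "\<And>t. (\<lambda>n. (chromatic_deriv n f t)\<^sup>2) sums c"
proof -
  from assms obtain g where cont: "continuous_on UNIV (\<lambda>t. complex_of_real (f t))"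
    and fg: "has_L2_fourier (\<lambda>t. complex_of_real (f t)) g"
    and 0: "AE \<omega> in lborel. \<omega> \<notin> {-pi..pi} \<longrightarrow> g \<omega> = 0"
    by (auto simp: BL_def)
  have g: "square_integrable g" using fg by (simp add: has_L2_fourier_def)
  have gi: "integrable lborel g"
    by (rule square_integrable_bounded_support_integrable[OF g 0])
  have f: "complex_of_real (f t) = ft g (- t) / complex_of_real (2 * pi)" for t
    by (rule has_L2_fourier_imp_eq_inverse_ft[OF fg cont 0])
  let ?u = "\<lambda>t \<omega>. g \<omega> * exp (\<i> * complex_of_real t * complex_of_real \<omega>)"
  \<comment> \<open>Modulation by e^(i\<omega>t) does not change |g|, so the value is free of t. The
    divisor (2\<pi>)^2 is the square of the one in the inverse transform.\<close>
  have "(\<lambda>n. (chromatic_deriv n f t)\<^sup>2) sums (2 * pi * (\<integral>\<omega>. (norm (g \<omega>))\<^sup>2 \<partial>lborel) / (2 * pi)\<^sup>2)" for t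
  proof -
    have [measurable]: "g \<in> borel_measurable borel" using gi by auto
    have u: "square_integrable (?u t)"
      by (rule square_integrable_mono[OF g]) (auto simp: norm_mult)
    have n: "(norm (\<integral>\<omega>. ?u t \<omega> * leg n \<omega> \<partial>lborel))\<^sup>2 / (2 * pi)\<^sup>2 = (chromatic_deriv n f t)\<^sup>2" for n
    proof -
      have "\<bar>chromatic_deriv n f t\<bar> = norm (chromatic_deriv_complex n f t)"
        by (simp flip: of_real_chromatic_deriv)
      also have "\<dots> = norm (\<integral>\<omega>. ?u t \<omega> * leg n \<omega> \<partial>lborel) / (2 * pi)"
        by (subst chromatic_deriv_complex_eq[OF gi 0 higher_deriv_eq_moment[OF gi 0 f]])
           (simp add: norm_mult norm_divide norm_power)
      finally show ?thesis by (metis power2_abs power_divide)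
    qed
    have "(\<lambda>n. (norm (\<integral>\<omega>. ?u t \<omega> * leg n \<omega> \<partial>lborel))\<^sup>2 / (2 * pi)\<^sup>2)
        sums (2 * pi * (\<integral>\<omega>. (norm (?u t \<omega>))\<^sup>2 \<partial>lborel) / (2 * pi)\<^sup>2)"
      by (intro sums_divide Legendre_Parseval u) (use 0 in auto)
    then show ?thesis by (simp only: n norm_mult norm_exp_i_times mult_1_right)
  qed
  then show ?thesis by (rule that)
qed

lemma summable_chromatic_imp_BL:
  fixes f :: "real \<Rightarrow> real"
  assumes F: "F holomorphic_on UNIV" "\<And>t. F (complex_of_real t) = complex_of_real (f t)"
    and a: "summable (\<lambda>n. (chromatic_deriv n f 0)\<^sup>2)"
  shows "(\<lambda>t. complex_of_real (f t)) \<in> BL pi"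
proof -
  \<comment> \<open>The factor (-i)^n undoes the i^n that relates chromatic derivatives to Legendre
    coefficients.\<close>
  define b where "b n = (- \<i>) ^ n * complex_of_real (chromatic_deriv n f 0)" for n
  have "summable (\<lambda>n. (norm (b n))\<^sup>2)"
    using a by (simp add: b_def norm_mult norm_power)
  then obtain g where g: "square_integrable g" "\<And>\<omega>. \<omega> \<notin> {-pi..pi} \<Longrightarrow> g \<omega> = 0"
    and gb: "\<And>n. (\<integral>\<omega>. g \<omega> * leg n \<omega> \<partial>lborel) = complex_of_real (2 * pi) * b n"
    by (rule Legendre_Riesz_Fischer) blast
  have 0: "AE \<omega> in lborel. \<omega> \<notin> {-pi..pi} \<longrightarrow> g \<omega> = 0"
    using g(2) by simp
  have gi: "integrable lborel g"
    by (rule square_integrable_bounded_support_integrable[OF g(1) 0])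
  have mom: "complex_of_real ((deriv ^^ k) f 0) = \<i> ^ k * moment g 0 k" for k
  proof (rule chromatic_derivs_determine_higher_derivs)
    fix n
    have "(\<Sum>k\<le>n. complex_of_real (coeff (normalized_Legendre n) k) * moment g 0 k) = b n"
      using gb[of n] integral_mult_leg_moments[OF gi 0, of n]
      by (simp add: moment_def flip: sum_divide_distrib)
    then show "chromatic_deriv_complex n f 0
        = \<i> ^ n * (\<Sum>k\<le>n. complex_of_real (coeff (normalized_Legendre n) k) * moment g 0 k)"
      by (simp add: b_def of_real_chromatic_deriv mult.assoc[symmetric] flip: power_mult_distrib)
  qed
  \<comment> \<open>Both sides have everywhere convergent Taylor series at 0, the left one because f
    extends to an entire function, and their coefficients agree by \<open>mom\<close>.\<close>
  have f: "complex_of_real (f t) = ft g (- t) / complex_of_real (2 * pi)" for t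
  proof (rule sums_unique2)
    show "(\<lambda>k. complex_of_real ((deriv ^^ k) f 0 / fact k * t ^ k)) sums complex_of_real (f t)"
      by (intro sums_of_real entire_real_Taylor[OF F])
    have "(\<lambda>k. \<i> ^ k * moment g 0 k / fact k * complex_of_real t ^ k) sums (ft g (- (0 + t)) / complex_of_real (2 * pi))"
      by (rule inverse_ft_sums[OF gi 0])
    then show "(\<lambda>k. complex_of_real ((deriv ^^ k) f 0 / fact k * t ^ k)) sums (ft g (- t) / complex_of_real (2 * pi))"
      by (simp add: mom)
  qed
  have L2: "has_L2_fourier (\<lambda>t. complex_of_real (f t)) g"
    unfolding f by (rule has_L2_fourier_inverse_ft[OF g(1) 0])
  have "continuous_on UNIV (\<lambda>t. complex_of_real (f t))"
    unfolding f by (intro continuous_intros continuous_on_compose2[OF continuous_ft[OF gi]]) auto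
  with L2 0 show ?thesis
    unfolding BL_def by (auto simp: has_L2_fourier_def)
qed

theorem proposition1p1:
  fixes f :: "real \<Rightarrow> real"
  assumes "\<exists>F :: complex \<Rightarrow> complex. F holomorphic_on UNIV \<and>
             (\<forall>t::real. F (complex_of_real t) = complex_of_real (f t))"
  shows "(summable (\<lambda>n. (chromatic_deriv n f 0)\<^sup>2) \<longleftrightarrow>
            (\<forall>t::real. summable (\<lambda>n. (chromatic_deriv n f t)\<^sup>2)) \<and>
            (\<forall>s t::real. (\<Sum>n. (chromatic_deriv n f s)\<^sup>2) = (\<Sum>n. (chromatic_deriv n f t)\<^sup>2)))
       \<and> ((\<forall>t::real. summable (\<lambda>n. (chromatic_deriv n f t)\<^sup>2)) \<and>
            (\<forall>s t::real. (\<Sum>n. (chromatic_deriv n f s)\<^sup>2) = (\<Sum>n. (chromatic_deriv n f t)\<^sup>2))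
          \<longleftrightarrow> (\<lambda>t. complex_of_real (f t)) \<in> BL pi)"
    (is "(?a \<longleftrightarrow> ?b) \<and> (?b \<longleftrightarrow> ?c)")
proof -
  obtain F :: "complex \<Rightarrow> complex"
    where F: "F holomorphic_on UNIV" "\<And>t. F (complex_of_real t) = complex_of_real (f t)"
    using assms by blast
  have "?b \<Longrightarrow> ?a" by blast
  moreover have "?a \<Longrightarrow> ?c" by (rule summable_chromatic_imp_BL[OF F])
  moreover have ?b if BL: ?c
  proof -
    obtain c where "\<And>t. (\<lambda>n. (chromatic_deriv n f t)\<^sup>2) sums c"
      using BL_chromatic_sums[OF BL] by blast
    then have "summable (\<lambda>n. (chromatic_deriv n f t)\<^sup>2)" "(\<Sum>n. (chromatic_deriv n f t)\<^sup>2) = c" for t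
      by (auto simp: sums_iff)
    then show ?thesis by simp
  qed
  ultimately show ?thesis by blast
qed

end
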